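(* Let $W$ be a (possibly infinite) Coxeter group with simple generators $S$, let $Q=(q_1,\dots,q_r)$ be a word in $S$, $\pi\in W$, and let $I$ be a facet of $\mathcal{SC}(Q,\pi)$. Let $F$ be a flat of $\mathsf r(I,Q)$, and let $J_F$, $W_F$, $Q_F$, $I_F$, $\pi_F$, $\bar I_F$ be as defined in the context. Then $F$ is the root function of the subword complex $\mathcal{SC}(Q_F,\pi_F)$ of type $W_F$ with respect to the facet $I_F$; that is, $I_F$ is a facet of $\mathcal{SC}(Q_F,\pi_F)$ and $\mathsf r_F(I_F,k)=\mathsf r(I,j_k)$ for every $k\in[r']$, where $\mathsf r_F$ denotes the root function computed in $W_F$. Moreover, $$\mathcal{SC}(Q_F,\pi_F)\cong \operatorname{Link}_{\mathcal{SC}(Q,\pi)}(I\setminus \bar I_F).$$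
   Context: $W$ acts on a real vector space $V$ with root system $\Phi=\Phi^+\sqcup\Phi^-$, $\Phi^-=-\Phi^+$, simple roots $\{\alpha_s:s\in S\}$. For a word $Q=(q_1,\dots,q_r)$ in $S$ and $\pi\in W$, the subword complex $\mathcal{SC}(Q,\pi)$ is the simplicial complex whose faces are the subsets $I\subseteq[r]$ such that the subword of $Q$ with positions in $[r]\setminus I$ contains a reduced expression of $\pi$; facets are maximal faces. For $X\subseteq[r]$, $\Pi_X\in W$ is the product of the letters $q_x$, $x\in X$, in the order of $Q$. The root function of $I$ is $\mathsf r(I,j):=\Pi_{[j-1]\setminus I}(\alpha_{q_j})$, and $\mathsf r(I,Q)=(\mathsf r(I,1),\dots,\mathsf r(I,r))$. A flat of a list $L$ of vectors is the sublist of all entries of $L$ lying in some linear subspace $U$. For a flat $F$ of $\mathsf r(I,Q)$: $V_F$ is the span of $F$; $\Phi_F=\Phi\cap V_F$ with positive roots $\Phi^+\cap V_F$ is a root system with simple roots $\Delta_F\subseteq\Phi^+$, and $W_F$ is its Coxeter group, generated by the reflections $s_\beta$, $\beta\in\Delta_F$. Let $J_F=\{j_1<\dots<j_{r'}\}$ be the positions $j$ with $\mathsf r(I,j)\in F$; for $k\in[r']$ let $\beta_k:=\Pi_{B_{j_k}}(\alpha_{q_{j_k}})$ with $B_j:=([j-1]\setminus I)\setminus J_F$ (each $\beta_k$ is a simple root of $\Phi_F$). Define $Q_F:=(q'_1,\dots,q'_{r'})$ where $q'_k$ is the generator of $W_F$ corresponding to the simple root $\beta_k$; $I_F:=\{k\in[r']: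 j_k\in I\}$; $\pi_F\in W_F$ the product of the letters of $Q_F$ in positions outside $I_F$ (in order); and $\bar I_F:=\{j_k : k\in I_F\}=\{i\in I:\mathsf r(I,i)\in F\}$. *)

theory Defs
  imports "HOL-Analysis.Analysis" "HOL-Algebra.Group_Action" "HOL-Algebra.Generated_Groups"
    "HOL-Library.Sublist"
begin

text \<open>
  Words are lists of group elements. Positions in a word are counted from 0, so that
  \<open>[r]\<close> becomes \<open>{..<length Q}\<close>, and the set of positions before \<open>j\<close> is \<open>{..<j}\<close>.
\<close>

section \<open>Coxeter groups\<close>

definition word_prod :: "('w, 'm) monoid_scheme \<Rightarrow> 'w list \<Rightarrow> 'w" where
  "word_prod G ws = foldr (\<lambda>x y. x \<otimes>\<^bsub>G\<^esub> y) ws \<one>\<^bsub>G\<^esub>"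

text \<open>
  An entry \<open>m s t = 0\<close> of a Coxeter matrix encodes \<open>m s t = \<infinity>\<close>. Since \<open>m s s = 1\<close>, the relations
  include \<open>s s = 1\<close>; hence the monoid with the presentation below is the group with that
  presentation, and words without inverse letters suffice.
\<close>

inductive coxeter_step :: "'w set \<Rightarrow> ('w \<Rightarrow> 'w \<Rightarrow> nat) \<Rightarrow> 'w list \<Rightarrow> 'w list \<Rightarrow> bool"
  for S :: "'w set" and m :: "'w \<Rightarrow> 'w \<Rightarrow> nat" where
  "\<lbrakk>s \<in> S; t \<in> S; set u \<subseteq> S; set v \<subseteq> S\<rbrakk>
    \<Longrightarrow> coxeter_step S m (u @ concat (replicate (m s t) [s, t]) @ v) (u @ v)"

definition coxeter_system :: "('w, 'x) monoid_scheme \<Rightarrow> 'w set \<Rightarrow> ('w \<Rightarrow> 'w \<Rightarrow> nat) \<Rightarrow> bool" where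
  "coxeter_system G S m \<longleftrightarrow>
     group G \<and> S \<subseteq> carrier G \<and> generate G S = carrier G \<and>
     (\<forall>s\<in>S. \<forall>t\<in>S. m s t = m t s \<and> (m s t = 1 \<longleftrightarrow> s = t)) \<and>
     (\<forall>u v. set u \<subseteq> S \<longrightarrow> set v \<subseteq> S \<longrightarrow>
        (word_prod G u = word_prod G v \<longleftrightarrow> equivclp (coxeter_step S m) u v))"

section \<open>Root systems\<close>

text \<open>
  A group with distinguished generators, an action on a real vector space \<open>'v\<close>, and a vector
  \<open>\<alpha>\<^sub>s\<close> for each generator \<open>s\<close>. The same structure serves for \<open>W\<close> and for its subgroups \<open>W\<^sub>F\<close>.
\<close>

record ('w, 'v) reflection_group =
  cgroup :: "'w monoid"
  cgens :: "'w set"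
  caction :: "'w \<Rightarrow> 'v \<Rightarrow> 'v"
  croot :: "'w \<Rightarrow> 'v"

text \<open>
  The Coxeter group acts through a symmetric bilinear form \<open>B\<close> in the usual way. Linear independence
  of the simple roots is relaxed to positive independence, so that the simple roots of the root
  subsystems \<open>\<Phi> \<inter> V\<^sub>F\<close>, which may be linearly dependent when \<open>W\<close> is infinite, are covered too.
  Simple roots need not be unit vectors; the condition on conjugate generators makes the root
  system reduced.
\<close>

definition coxeter_root_system ::
    "('w, 'v::real_vector) reflection_group \<Rightarrow> ('w \<Rightarrow> 'w \<Rightarrow> nat) \<Rightarrow> ('v \<Rightarrow> 'v \<Rightarrow> real) \<Rightarrow> bool" where
  "coxeter_root_system R m B \<longleftrightarrow>
     (let W = cgroup R; S = cgens R; act = caction R; \<alpha> = croot R in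
      coxeter_system W S m \<and>
      group_action W UNIV act \<and> (\<forall>w\<in>carrier W. linear (act w)) \<and>
      bilinear B \<and> (\<forall>x y. B x y = B y x) \<and>
      (\<forall>s\<in>S. B (\<alpha> s) (\<alpha> s) > 0) \<and>
      (\<forall>s\<in>S. \<forall>v. act s v = v - (2 * B v (\<alpha> s) / B (\<alpha> s) (\<alpha> s)) *\<^sub>R \<alpha> s) \<and>
      (\<forall>s\<in>S. \<forall>t\<in>S. m s t \<noteq> 0 \<longrightarrow>
         B (\<alpha> s) (\<alpha> t) = - sqrt (B (\<alpha> s) (\<alpha> s) * B (\<alpha> t) (\<alpha> t)) * cos (pi / real (m s t))) \<and>
      (\<forall>s\<in>S. \<forall>t\<in>S. m s t = 0 \<longrightarrow>
         B (\<alpha> s) (\<alpha> t) \<le> - sqrt (B (\<alpha> s) (\<alpha> s) * B (\<alpha> t) (\<alpha> t))) \<and>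
      (\<forall>s\<in>S. \<forall>t\<in>S. \<forall>w\<in>carrier W. s = w \<otimes>\<^bsub>W\<^esub> t \<otimes>\<^bsub>W\<^esub> inv\<^bsub>W\<^esub> w \<longrightarrow>
         B (\<alpha> s) (\<alpha> s) = B (\<alpha> t) (\<alpha> t)) \<and>
      (\<forall>T c. finite T \<longrightarrow> T \<subseteq> S \<longrightarrow> (\<forall>s\<in>T. c s \<ge> 0) \<longrightarrow> (\<Sum>s\<in>T. c s *\<^sub>R \<alpha> s) = 0 \<longrightarrow>
         (\<forall>s\<in>T. c s = (0::real))))"

definition roots :: "('w, 'v) reflection_group \<Rightarrow> 'v set" where
  "roots R = {caction R w (croot R s) | w s. w \<in> carrier (cgroup R) \<and> s \<in> cgens R}"

definition pos_roots :: "('w, 'v::real_vector) reflection_group \<Rightarrow> 'v set" where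
  "pos_roots R = roots R \<inter> (convex_cone hull (croot R ` cgens R))"

text \<open>The reflection \<open>s\<^sub>\<beta>\<close> in a root \<open>\<beta> = w(\<alpha>\<^sub>s)\<close> is \<open>w s w\<^sup>-\<^sup>1\<close>.\<close>

definition root_reflection :: "('w, 'v) reflection_group \<Rightarrow> 'v \<Rightarrow> 'w" where
  "root_reflection R \<beta> =
     (THE t. \<exists>w\<in>carrier (cgroup R). \<exists>s\<in>cgens R.
        \<beta> = caction R w (croot R s) \<and> t = w \<otimes>\<^bsub>cgroup R\<^esub> s \<otimes>\<^bsub>cgroup R\<^esub> inv\<^bsub>cgroup R\<^esub> w)"

section \<open>Simplicial complexes\<close>

definition facets :: "'a set set \<Rightarrow> 'a set set" where
  "facets K = {A \<in> K. \<forall>C\<in>K. A \<subseteq> C \<longrightarrow> C = A}"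

definition link :: "'a set set \<Rightarrow> 'a set \<Rightarrow> 'a set set" where
  "link K A = {C \<in> K. C \<inter> A = {} \<and> C \<union> A \<in> K}"

text \<open>The vertices of a complex are the elements of its faces, so the vertex set is \<open>\<Union>K\<close>.\<close>

definition simplicial_isomorphic :: "'a set set \<Rightarrow> 'b set set \<Rightarrow> bool" where
  "simplicial_isomorphic K L \<longleftrightarrow>
     (\<exists>f. bij_betw f (\<Union>K) (\<Union>L) \<and> (\<forall>A. A \<subseteq> \<Union>K \<longrightarrow> (A \<in> K \<longleftrightarrow> f ` A \<in> L)))"

section \<open>Subword complexes and root functions\<close>

definition reduced_expression :: "('w, 'v) reflection_group \<Rightarrow> 'w \<Rightarrow> 'w list \<Rightarrow> bool" where
  "reduced_expression R \<pi> u \<longleftrightarrow>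
     set u \<subseteq> cgens R \<and> word_prod (cgroup R) u = \<pi> \<and>
     (\<forall>v. set v \<subseteq> cgens R \<and> word_prod (cgroup R) v = \<pi> \<longrightarrow> length u \<le> length v)"

definition subword_complex :: "('w, 'v) reflection_group \<Rightarrow> 'w list \<Rightarrow> 'w \<Rightarrow> nat set set" where
  "subword_complex R Q \<pi> =
     {I. I \<subseteq> {..<length Q} \<and>
         (\<exists>u. subseq u (nths Q ({..<length Q} - I)) \<and> reduced_expression R \<pi> u)}"

definition subword_prod :: "('w, 'v) reflection_group \<Rightarrow> 'w list \<Rightarrow> nat set \<Rightarrow> 'w" where
  "subword_prod R Q X = word_prod (cgroup R) (nths Q X)"

definition root_function :: "('w, 'v) reflection_group \<Rightarrow> 'w list \<Rightarrow> nat set \<Rightarrow> nat \<Rightarrow> 'v" where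
  "root_function R Q I j = caction R (subword_prod R Q ({..<j} - I)) (croot R (Q ! j))"

definition root_list :: "('w, 'v) reflection_group \<Rightarrow> 'w list \<Rightarrow> nat set \<Rightarrow> 'v list" where
  "root_list R Q I = map (root_function R Q I) [0..<length Q]"

section \<open>Flats\<close>

definition is_flat :: "'v::real_vector list \<Rightarrow> 'v list \<Rightarrow> bool" where
  "is_flat F L \<longleftrightarrow> (\<exists>U. subspace U \<and> F = filter (\<lambda>v. v \<in> U) L)"

definition flat_pos_roots :: "('w, 'v::real_vector) reflection_group \<Rightarrow> 'v list \<Rightarrow> 'v set" where
  "flat_pos_roots R F = pos_roots R \<inter> span (set F)"

text \<open>
  The simple roots \<open>\<Delta>\<^sub>F\<close> of \<open>\<Phi>\<^sub>F = \<Phi> \<inter> V\<^sub>F\<close>: the positive roots of \<open>\<Phi>\<^sub>F\<close> that are not nonnegative linear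
  combinations of the other positive roots of \<open>\<Phi>\<^sub>F\<close>.
\<close>

definition flat_simple_roots :: "('w, 'v::real_vector) reflection_group \<Rightarrow> 'v list \<Rightarrow> 'v set" where
  "flat_simple_roots R F =
     {\<beta> \<in> flat_pos_roots R F. \<beta> \<notin> convex_cone hull (flat_pos_roots R F - {\<beta>})}"

text \<open>
  The group \<open>W\<^sub>F\<close> generated by the \<open>s\<^sub>\<beta>\<close>, \<open>\<beta> \<in> \<Delta>\<^sub>F\<close>, as a subgroup of \<open>W\<close> with the restricted action;
  the simple root of the generator \<open>s\<^sub>\<beta>\<close> is \<open>\<beta>\<close>.
\<close>

definition flat_group ::
    "('w, 'v::real_vector) reflection_group \<Rightarrow> 'v list \<Rightarrow> ('w, 'v) reflection_group" where
  "flat_group R F =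
     \<lparr>cgroup = (cgroup R)\<lparr>carrier := generate (cgroup R) (root_reflection R ` flat_simple_roots R F)\<rparr>,
      cgens = root_reflection R ` flat_simple_roots R F,
      caction = caction R,
      croot = (\<lambda>t. THE \<beta>. \<beta> \<in> flat_simple_roots R F \<and> root_reflection R \<beta> = t)\<rparr>"

definition flat_positions ::
    "('w, 'v) reflection_group \<Rightarrow> 'w list \<Rightarrow> nat set \<Rightarrow> 'v list \<Rightarrow> nat set" where
  "flat_positions R Q I F = {j. j < length Q \<and> root_function R Q I j \<in> set F}"

text \<open>The position \<open>j\<^sub>k\<close>.\<close>

definition flat_pos ::
    "('w, 'v) reflection_group \<Rightarrow> 'w list \<Rightarrow> nat set \<Rightarrow> 'v list \<Rightarrow> nat \<Rightarrow> nat" where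
  "flat_pos R Q I F k = sorted_list_of_set (flat_positions R Q I F) ! k"

text \<open>The root \<open>\<beta>\<^sub>k\<close>.\<close>

definition flat_beta ::
    "('w, 'v) reflection_group \<Rightarrow> 'w list \<Rightarrow> nat set \<Rightarrow> 'v list \<Rightarrow> nat \<Rightarrow> 'v" where
  "flat_beta R Q I F k =
     (let j = flat_pos R Q I F k in
      caction R (subword_prod R Q (({..<j} - I) - flat_positions R Q I F)) (croot R (Q ! j)))"

text \<open>The word \<open>Q\<^sub>F\<close>, the set \<open>I\<^sub>F\<close>, the element \<open>\<pi>\<^sub>F\<close>, and the set of positions \<open>j\<^sub>k\<close>, \<open>k \<in> I\<^sub>F\<close>.\<close>

definition flat_word ::
    "('w, 'v) reflection_group \<Rightarrow> 'w list \<Rightarrow> nat set \<Rightarrow> 'v list \<Rightarrow> 'w list" where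
  "flat_word R Q I F =
     map (\<lambda>k. root_reflection R (flat_beta R Q I F k)) [0..<card (flat_positions R Q I F)]"

definition flat_facet ::
    "('w, 'v) reflection_group \<Rightarrow> 'w list \<Rightarrow> nat set \<Rightarrow> 'v list \<Rightarrow> nat set" where
  "flat_facet R Q I F = {k. k < card (flat_positions R Q I F) \<and> flat_pos R Q I F k \<in> I}"

definition flat_element ::
    "('w, 'v::real_vector) reflection_group \<Rightarrow> 'w list \<Rightarrow> nat set \<Rightarrow> 'v list \<Rightarrow> 'w" where
  "flat_element R Q I F =
     subword_prod (flat_group R F) (flat_word R Q I F)
       ({..<length (flat_word R Q I F)} - flat_facet R Q I F)"

definition flat_bar ::
    "('w, 'v) reflection_group \<Rightarrow> 'w list \<Rightarrow> nat set \<Rightarrow> 'v list \<Rightarrow> nat set" where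
  "flat_bar R Q I F = flat_pos R Q I F ` flat_facet R Q I F"

end

theory Submission
  imports Defs
begin

text \<open>
  Let \<open>V\<close> be the span of \<open>F\<close> and let \<open>x\<^sub>n\<close> be the product of the letters before position \<open>n\<close> outside \<open>I\<close>
  and outside the positions of the flat. The inverse of \<open>x\<^sub>n\<close> sends no positive root of \<open>\<Phi>\<^sub>F\<close> to a negative
  one, so \<open>\<beta>\<^sub>k\<close> is extremal among the positive roots of \<open>\<Phi>\<^sub>F\<close>, because a simple root is extremal among
  all positive roots. If \<open>X\<close> agrees with the complement of \<open>I\<close> outside the flat, moving the letters of
  the flat to the left gives \<open>\<Pi>\<^sub>X = p\<^sub>X x\<^sub>r\<close> with \<open>p\<^sub>X\<close> the corresponding product in \<open>W\<^sub>F\<close>; this yields the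
  root functions and matches reduced expressions for \<open>\<pi>\<close> with those for \<open>\<pi>\<^sub>F\<close>. The length in \<open>W\<^sub>F\<close> is
  controlled by counting inversions in \<open>\<Phi>\<^sub>F\<close>, so no Coxeter presentation of \<open>W\<^sub>F\<close> is needed. It remains
  to see that every facet containing the part of \<open>I\<close> outside the flat agrees with \<open>I\<close> there; this follows
  by induction on the word, using a flip whenever the first letter belongs to only one of two facets.
\<close>

section \<open>Words and Coxeter groups\<close>

text \<open>What survives is extremality: a simple root is not a conic combination of the other
  positive roots. In \<open>W\<close> this follows from the signs of the form on pairs of simple
  roots together with positive independence. For the flat it is the definition of
  \<open>flat_simple_roots\<close>, so the fact that a simple reflection permutes the remaining
  positive roots can be proved at both levels. A subword complex sees its group only through which
  words are reduced; for \<open>W\<^sub>F\<close> it is therefore enough to certify minimal length.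
  The induction that compares two facets has to be run for an arbitrary subspace instead of the span
  of \<open>F\<close>, because cancelling a common first letter replaces the subspace by its
  preimage under that letter.\<close>

lemma word_prod_Nil [simp]: "word_prod G [] = \<one>\<^bsub>G\<^esub>"
  by (simp add: word_prod_def)

lemma word_prod_Cons [simp]: "word_prod G (x # xs) = x \<otimes>\<^bsub>G\<^esub> word_prod G xs"
  by (simp add: word_prod_def)

lemma word_prod_carrier_update [simp]: "word_prod (G\<lparr>carrier := A\<rparr>) u = word_prod G u"
  by (induction u) simp_all

context group
begin

lemma word_prod_closed [simp]: "set u \<subseteq> carrier G \<Longrightarrow> word_prod G u \<in> carrier G"
  by (induction u) auto

lemma word_prod_append:
  "set u \<subseteq> carrier G \<Longrightarrow> set v \<subseteq> carrier G
    \<Longrightarrow> word_prod G (u @ v) = word_prod G u \<otimes> word_prod G v"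
  by (induction u) (auto simp: m_assoc)

lemma word_prod_in_generate: "set u \<subseteq> A \<Longrightarrow> word_prod G u \<in> generate G A"
  by (induction u) (auto intro: generate.intros)

lemma generate_involutions_word:
  assumes "A \<subseteq> carrier G" and "\<And>s. s \<in> A \<Longrightarrow> inv s = s" and "g \<in> generate G A"
  shows "\<exists>u. set u \<subseteq> A \<and> word_prod G u = g"
  using assms(3)
proof (induction rule: generate.induct)
  case one
  show ?case by (rule exI [of _ "[]"]) simp
next
  case (incl h)
  then show ?case using assms(1) by (intro exI [of _ "[h]"]) auto
next
  case (inv h)
  then show ?case using assms(1,2) by (intro exI [of _ "[h]"]) auto
next
  case (eng g h)
  then obtain u v where "set u \<subseteq> A" "word_prod G u = g" "set v \<subseteq> A" "word_prod G v = h" by blast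
  then show ?case using assms(1) by (intro exI [of _ "u @ v"]) (auto simp: word_prod_append)
qed

end

section \<open>Alternating words and Chebyshev polynomials\<close>

fun alternating_word :: "nat \<Rightarrow> 'a \<Rightarrow> 'a \<Rightarrow> 'a list" where
  "alternating_word 0 s t = []"
| "alternating_word (Suc n) s t = (if even n then t else s) # alternating_word n s t"

lemma length_alternating_word [simp]: "length (alternating_word n s t) = n"
  by (induction n) auto

lemma set_alternating_word: "set (alternating_word n s t) \<subseteq> {s, t}"
  by (induction n) auto

text \<open>The recursion adds letters at the front, so the last letter is always \<open>t\<close>
  and only the first one depends on parity. Splitting off the last letter swaps \<open>s\<close> and
  \<open>t\<close>.\<close>

lemma alternating_word_snoc: "alternating_word (Suc n) s t = alternating_word n t s @ [t]"
  by (induction n) auto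

lemma alternating_word_suffix:
  "k \<le> n \<Longrightarrow> \<exists>p. alternating_word n s t = p @ alternating_word k s t \<and> set p \<subseteq> {s, t}"
proof (induction n)
  case (Suc n)
  show ?case
  proof (cases "k = Suc n")
    case False
    then obtain p where "alternating_word n s t = p @ alternating_word k s t" "set p \<subseteq> {s, t}"
      using Suc by auto
    then show ?thesis
      by (intro exI [of _ "(if even n then t else s) # p"]) auto
  qed auto
qed auto

text \<open>Chebyshev polynomials of the second kind with the index shifted by one: at
  \<open>c = cos x\<close> the value is \<open>sin (n x) / sin x\<close> when \<open>sin x\<close>
  is nonzero.\<close>

fun chebyshev_U :: "real \<Rightarrow> nat \<Rightarrow> real" where
  "chebyshev_U c 0 = 0"
| "chebyshev_U c (Suc 0) = 1"
| "chebyshev_U c (Suc (Suc n)) = 2 * c * chebyshev_U c (Suc n) - chebyshev_U c n"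

lemma chebyshev_U_cos: "sin x * chebyshev_U (cos x) n = sin (real n * x)"
proof (induction n rule: induct_nat_012)
  case (ge2 n)
  have "sin (real (Suc (Suc n)) * x) + sin (real n * x) = 2 * cos x * sin (real (Suc n) * x)"
    using sin_plus_sin [of "real (Suc (Suc n)) * x" "real n * x"]
    by (simp add: algebra_simps add_divide_distrib)
  then show ?case using ge2 by (simp add: algebra_simps)
qed auto

lemma chebyshev_U_nonneg_cos:
  assumes "2 \<le> m" "n \<le> m"
  shows "chebyshev_U (cos (pi / real m)) n \<ge> 0"
proof -
  have "pi / real m > 0" "pi / real m < pi"
    using assms by (auto simp: divide_simps)
  then have pos: "sin (pi / real m) > 0" by (rule sin_gt_zero)
  have "real n * (pi / real m) \<le> pi"
    using assms by (auto simp: divide_simps)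
  then have "sin (real n * (pi / real m)) \<ge> 0" by (intro sin_ge_zero) auto
  then show ?thesis
    using pos chebyshev_U_cos [of "pi / real m" n] by (metis zero_le_mult_iff not_less)
qed

text \<open>Covers generators with infinite \<open>m s t\<close>, where the parameter is at least 1
  and is no longer given by an angle. Monotonicity is carried along because nonnegativity alone is
  not inductive.\<close>

lemma chebyshev_U_mono:
  assumes "1 \<le> c"
  shows "0 \<le> chebyshev_U c n \<and> chebyshev_U c n \<le> chebyshev_U c (Suc n)"
proof (induction n)
  case (Suc n)
  have "1 * chebyshev_U c (Suc n) \<le> c * chebyshev_U c (Suc n)"
    using Suc assms by (intro mult_right_mono) auto
  then show ?case using Suc by simp
qed auto

section \<open>Presentation and length function\<close>

locale coxeter_roots =
  fixes R :: "('w, 'v::real_vector) reflection_group"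
    and m :: "'w \<Rightarrow> 'w \<Rightarrow> nat" and B :: "'v \<Rightarrow> 'v \<Rightarrow> real"
  assumes root_system: "coxeter_root_system R m B"
begin

abbreviation "W \<equiv> cgroup R"
abbreviation "S \<equiv> cgens R"
abbreviation "act \<equiv> caction R"
abbreviation "rt \<equiv> croot R"
abbreviation mult_W (infixl "\<bullet>" 70) where "g \<bullet> h \<equiv> g \<otimes>\<^bsub>W\<^esub> h"
abbreviation "inv_W g \<equiv> inv\<^bsub>W\<^esub> g"
abbreviation "wp u \<equiv> word_prod W u"

sublocale W: group W
  using root_system by (simp add: coxeter_root_system_def coxeter_system_def Let_def)

lemma cox: "coxeter_system W S m"
  using root_system by (simp add: coxeter_root_system_def Let_def)

lemma gens_carrier: "S \<subseteq> carrier W"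
  using cox by (simp add: coxeter_system_def)

lemma gens_closed [simp, intro]: "s \<in> S \<Longrightarrow> s \<in> carrier W"
  using gens_carrier by auto

lemma word_closed [simp, intro]: "set u \<subseteq> S \<Longrightarrow> wp u \<in> carrier W"
  using gens_carrier by (meson W.word_prod_closed subset_trans)

lemma word_append: "set u \<subseteq> S \<Longrightarrow> set v \<subseteq> S \<Longrightarrow> wp (u @ v) = wp u \<bullet> wp v"
  using gens_carrier by (meson W.word_prod_append subset_trans)

lemma m_commute: "s \<in> S \<Longrightarrow> t \<in> S \<Longrightarrow> m s t = m t s"
  and m_eq_1_iff: "s \<in> S \<Longrightarrow> t \<in> S \<Longrightarrow> m s t = 1 \<longleftrightarrow> s = t"
  and word_eq_iff: "set u \<subseteq> S \<Longrightarrow> set v \<subseteq> S \<Longrightarrow>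
    wp u = wp v \<longleftrightarrow> equivclp (coxeter_step S m) u v"
  using cox by (auto simp: coxeter_system_def)

lemma braid_relation: "s \<in> S \<Longrightarrow> t \<in> S \<Longrightarrow> wp (concat (replicate (m s t) [s, t])) = \<one>\<^bsub>W\<^esub>"
  using word_eq_iff [of "concat (replicate (m s t) [s, t])" "[]"]
    coxeter_step.intros [of s S t "[]" "[]" m]
  by (auto simp: r_into_equivclp)

lemma gen_square [simp]: "s \<in> S \<Longrightarrow> s \<bullet> s = \<one>\<^bsub>W\<^esub>"
  using braid_relation [of s s] m_eq_1_iff [of s s] by simp

lemma gen_inv [simp]: "s \<in> S \<Longrightarrow> inv_W s = s"
  by (simp add: W.inv_equality)

lemma gen_cancel [simp]: "s \<in> S \<Longrightarrow> w \<in> carrier W \<Longrightarrow> s \<bullet> (s \<bullet> w) = w"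
  by (metis W.l_one W.m_assoc gen_square gens_closed)

lemma gen_cancel_right [simp]: "s \<in> S \<Longrightarrow> w \<in> carrier W \<Longrightarrow> w \<bullet> s \<bullet> s = w"
  by (simp add: W.m_assoc)

text \<open>Every relator has even length \<open>2 * m s t\<close>, so parity is invariant under
  rewriting. It follows that a generator always changes the length of an element.\<close>

lemma word_parity:
  assumes "set u \<subseteq> S" "set v \<subseteq> S" "wp u = wp v"
  shows "even (length u) \<longleftrightarrow> even (length v)"
proof -
  have step: "even (length x) \<longleftrightarrow> even (length y)" if "coxeter_step S m x y" for x y
    using that by cases (auto simp: length_concat sum_list_replicate)
  have "equivclp (coxeter_step S m) u v"
    using assms word_eq_iff by auto
  then show ?thesis
    by (induction rule: equivclp_induct) (auto dest: step)
qed

lemma word_exists: "w \<in> carrier W \<Longrightarrow> \<exists>u. set u \<subseteq> S \<and> wp u = w"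
  using W.generate_involutions_word [of S w] cox gens_carrier by (auto simp: coxeter_system_def)

definition len :: "'w \<Rightarrow> nat" where
  "len w = (LEAST n. \<exists>u. set u \<subseteq> S \<and> wp u = w \<and> length u = n)"

lemma len_le: "set u \<subseteq> S \<Longrightarrow> len (wp u) \<le> length u"
  unfolding len_def by (rule Least_le) auto

lemma len_word:
  assumes "w \<in> carrier W"
  obtains u where "set u \<subseteq> S" "wp u = w" "length u = len w"
proof -
  have "\<exists>u. set u \<subseteq> S \<and> wp u = w \<and> length u = len w"
    unfolding len_def by (rule LeastI_ex) (use word_exists [OF assms] in auto)
  then show ?thesis using that by auto
qed

lemma reduced_expression_iff:
  "reduced_expression R w u \<longleftrightarrow> set u \<subseteq> S \<and> wp u = w \<and> length u = len w"
proof
  assume *: "reduced_expression R w u"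
  then have "w \<in> carrier W" by (auto simp: reduced_expression_def)
  from len_word [OF this] show "set u \<subseteq> S \<and> wp u = w \<and> length u = len w"
    using * len_le [of u] unfolding reduced_expression_def by (metis le_antisym)
next
  assume "set u \<subseteq> S \<and> wp u = w \<and> length u = len w"
  then show "reduced_expression R w u"
    unfolding reduced_expression_def by (metis len_le)
qed

lemma len_mult_le: "g \<in> carrier W \<Longrightarrow> h \<in> carrier W \<Longrightarrow> len (g \<bullet> h) \<le> len g + len h"
  by (metis len_word len_le word_append length_append le_sup_iff set_append)

lemma len_one [simp]: "len \<one>\<^bsub>W\<^esub> = 0"
  using len_le [of "[]"] by simp

lemma len_gen: "s \<in> S \<Longrightarrow> len s \<le> 1"
  using len_le [of "[s]"] by simp

lemma len_gen_neq:
  assumes "w \<in> carrier W" "s \<in> S"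
  shows "len (w \<bullet> s) \<noteq> len w"
proof -
  obtain u where u: "set u \<subseteq> S" "wp u = w" "length u = len w"
    using len_word assms(1) by blast
  obtain v where v: "set v \<subseteq> S" "wp v = w \<bullet> s" "length v = len (w \<bullet> s)"
    using len_word [of "w \<bullet> s"] assms by auto
  have "wp (u @ [s]) = wp v" using u v assms by (simp add: word_append)
  then have "even (length (u @ [s])) \<longleftrightarrow> even (length v)"
    using u v assms by (intro word_parity) auto
  then show ?thesis using u v by auto
qed

text \<open>Cuts \<open>(st)^n\<close> or \<open>(ts)^n\<close> in the middle: the second half is
  the inverse of \<open>alternating_word n t s\<close>. Proved for every \<open>n\<close> so that
  induction applies; \<open>n = m s t\<close> gives the braid relation.\<close>

lemma alternating_word_quotient:
  assumes "s \<in> S" "t \<in> S"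
  shows "wp (alternating_word n s t) =
    wp (concat (replicate n (if even n then [s, t] else [t, s]))) \<bullet> wp (alternating_word n t s)"
proof (induction n)
  case (Suc n)
  define z where "z = (if even n then t else s)"
  define z' where "z' = (if even n then s else t)"
  define P where "P = concat (replicate n [z', z])"
  define b where "b = wp (alternating_word n t s)"
  have z: "z \<in> S" "z' \<in> S" using assms by (auto simp: z_def z'_def)
  have P: "set P \<subseteq> S" using z by (auto simp: P_def)
  have b: "b \<in> carrier W"
    unfolding b_def using assms set_alternating_word [of n t s] by (intro word_closed) auto
  \<comment> \<open>A new first letter swaps the roles of the two letters, so the power has to be
    rotated by one place.\<close>
  have rot: "z # concat (replicate k [z', z]) @ [z'] = concat (replicate (Suc k) [z, z'])" for k
    by (induction k) auto
  have "wp (alternating_word n s t) = wp P \<bullet> b"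
    using Suc unfolding b_def by (auto simp: P_def z_def z'_def split: if_splits)
  moreover have "wp (concat (replicate (Suc n) [z, z'])) = z \<bullet> (wp P \<bullet> z')"
    using z P unfolding P_def rot [of n, symmetric]
    by (simp add: word_append del: replicate_Suc)
  moreover have "(z \<bullet> (wp P \<bullet> z')) \<bullet> (z' \<bullet> b) = z \<bullet> (wp P \<bullet> b)"
    using z b P by (simp add: W.m_assoc)
  ultimately show ?case
    by (auto simp: z_def z'_def b_def split: if_splits)
qed auto

lemma alternating_word_braid:
  assumes "s \<in> S" "t \<in> S"
  shows "wp (alternating_word (m s t) s t) = wp (alternating_word (m s t) t s)"
proof -
  have "wp (alternating_word (m s t) t s) \<in> carrier W"
    using assms set_alternating_word [of "m s t" t s] by (intro word_closed) auto
  then show ?thesis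
    using alternating_word_quotient [OF assms, of "m s t"] braid_relation [of s t]
      braid_relation [of t s] assms m_commute [of s t]
    by (auto split: if_splits)
qed

section \<open>Positivity of roots\<close>

lemmas root_system_conjs = root_system [unfolded coxeter_root_system_def Let_def, THEN conjunct2]

lemma action: "group_action W UNIV act"
  using root_system_conjs by (rule conjunct1)

lemma act_linear: "w \<in> carrier W \<Longrightarrow> linear (act w)"
  using root_system_conjs [THEN conjunct2, THEN conjunct1] by blast

lemma B_bilinear: "bilinear B"
  using root_system_conjs [THEN conjunct2, THEN conjunct2] by (rule conjunct1)

lemmas root_system_conjs' = root_system_conjs [THEN conjunct2, THEN conjunct2, THEN conjunct2]

lemma B_commute: "B x y = B y x"
  using root_system_conjs' [THEN conjunct1] by blast

lemma B_gen_pos: "s \<in> S \<Longrightarrow> B (rt s) (rt s) > 0"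
  using root_system_conjs' [THEN conjunct2, THEN conjunct1] by blast

lemma act_gen: "s \<in> S \<Longrightarrow> act s v = v - (2 * B v (rt s) / B (rt s) (rt s)) *\<^sub>R rt s"
  using root_system_conjs' [THEN conjunct2, THEN conjunct2, THEN conjunct1] by blast

lemmas root_system_conjs'' = root_system_conjs' [THEN conjunct2, THEN conjunct2, THEN conjunct2]

lemma B_gens: "s \<in> S \<Longrightarrow> t \<in> S \<Longrightarrow> m s t \<noteq> 0 \<Longrightarrow>
    B (rt s) (rt t) = - sqrt (B (rt s) (rt s) * B (rt t) (rt t)) * cos (pi / real (m s t))"
  using root_system_conjs'' [THEN conjunct1] by blast

lemma B_gens_infinite: "s \<in> S \<Longrightarrow> t \<in> S \<Longrightarrow> m s t = 0 \<Longrightarrow>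
    B (rt s) (rt t) \<le> - sqrt (B (rt s) (rt s) * B (rt t) (rt t))"
  using root_system_conjs'' [THEN conjunct2, THEN conjunct1] by blast

lemma B_conjugate: "s \<in> S \<Longrightarrow> t \<in> S \<Longrightarrow> w \<in> carrier W \<Longrightarrow> s = w \<bullet> t \<bullet> inv_W w
    \<Longrightarrow> B (rt s) (rt s) = B (rt t) (rt t)"
  using root_system_conjs'' [THEN conjunct2, THEN conjunct2, THEN conjunct1] by blast

lemma positively_independent:
  assumes "finite T" "T \<subseteq> S" "\<And>s. s \<in> T \<Longrightarrow> c s \<ge> (0::real)"
    "(\<Sum>s\<in>T. c s *\<^sub>R rt s) = 0" "s \<in> T"
  shows "c s = 0"
  using root_system_conjs'' [THEN conjunct2, THEN conjunct2, THEN conjunct2, rule_format, of T c s] assms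
  by blast

lemma act_one [simp]: "act \<one>\<^bsub>W\<^esub> v = v"
  using group_action.id_eq_one [OF action] by (metis UNIV_I restrict_apply')

lemma act_mult: "g \<in> carrier W \<Longrightarrow> h \<in> carrier W \<Longrightarrow> act (g \<bullet> h) v = act g (act h v)"
  using group_action.composition_rule [OF action] by auto

lemma act_inv_act [simp]: "g \<in> carrier W \<Longrightarrow> act (inv_W g) (act g v) = v"
  and act_act_inv [simp]: "g \<in> carrier W \<Longrightarrow> act g (act (inv_W g) v) = v"
  by (simp_all flip: act_mult)

lemma act_eq_iff [simp]: "g \<in> carrier W \<Longrightarrow> act g v = act g v' \<longleftrightarrow> v = v'"
  by (metis act_inv_act)

lemma act_gen_gen [simp]: "s \<in> S \<Longrightarrow> act s (act s v) = v"
  by (simp flip: act_mult)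

lemma act_add: "w \<in> carrier W \<Longrightarrow> act w (x + y) = act w x + act w y"
  and act_diff: "w \<in> carrier W \<Longrightarrow> act w (x - y) = act w x - act w y"
  and act_minus: "w \<in> carrier W \<Longrightarrow> act w (- x) = - act w x"
  and act_scaleR: "w \<in> carrier W \<Longrightarrow> act w (c *\<^sub>R x) = c *\<^sub>R act w x"
  and act_zero: "w \<in> carrier W \<Longrightarrow> act w 0 = 0"
  by (simp_all add: act_linear linear_add linear_diff linear_neg linear_cmul linear_0)

lemma act_gen_root: "s \<in> S \<Longrightarrow> act s (rt s) = - rt s"
  using B_gen_pos [of s] by (simp add: act_gen scaleR_2)

lemmas B_simps = bilinear_ladd [OF B_bilinear] bilinear_radd [OF B_bilinear]
  bilinear_lsub [OF B_bilinear] bilinear_rsub [OF B_bilinear]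
  bilinear_lmul [OF B_bilinear] bilinear_rmul [OF B_bilinear]

lemma B_invariant_gen:
  assumes "s \<in> S" shows "B (act s x) (act s y) = B x y"
proof -
  have "B (rt s) y = B y (rt s)" by (rule B_commute)
  then show ?thesis
    using B_gen_pos [OF assms] by (simp add: act_gen assms B_simps field_simps)
qed

lemma B_invariant:
  assumes "w \<in> carrier W" shows "B (act w x) (act w y) = B x y"
proof -
  have "B (act (wp u) x) (act (wp u) y) = B x y" if "set u \<subseteq> S" for u
    using that
  proof (induction u)
    case (Cons s u)
    then have "act (wp (s # u)) v = act s (act (wp u) v)" for v
      by (simp add: act_mult)
    then show ?case using Cons by (simp add: B_invariant_gen)
  qed simp
  then show ?thesis using len_word [OF assms] by metis
qed

section \<open>The cone spanned by the simple roots\<close>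

definition cone :: "'v set" where
  "cone = convex_cone hull (rt ` S)"

lemma cone_add: "x \<in> cone \<Longrightarrow> y \<in> cone \<Longrightarrow> x + y \<in> cone"
  and cone_scaleR: "x \<in> cone \<Longrightarrow> 0 \<le> c \<Longrightarrow> c *\<^sub>R x \<in> cone"
  and cone_gen: "s \<in> S \<Longrightarrow> rt s \<in> cone"
  and cone_convex_cone: "convex_cone cone"
  unfolding cone_def
  by (auto intro: convex_cone_hull_add convex_cone_hull_mul hull_inc convex_cone_convex_cone_hull)

lemma cone_scaleR_iff: "0 < c \<Longrightarrow> c *\<^sub>R x \<in> cone \<longleftrightarrow> x \<in> cone"
  using cone_scaleR [of x c] cone_scaleR [of "c *\<^sub>R x" "inverse c"] by auto

text \<open>The coefficients vanish off \<open>T\<close> and are nonnegative everywhere, so two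
  combinations can be rewritten over the union of their index sets and added.\<close>

lemma cone_combination:
  assumes "x \<in> cone"
  obtains T c where "finite T" "T \<subseteq> S" "\<And>s. c s \<ge> (0::real)" "\<And>s. s \<notin> T \<Longrightarrow> c s = 0"
    "x = (\<Sum>s\<in>T. c s *\<^sub>R rt s)"
proof -
  define P where "P x \<longleftrightarrow> (\<exists>T c. finite T \<and> T \<subseteq> S \<and> (\<forall>s. c s \<ge> (0::real)) \<and> (\<forall>s. s \<notin> T \<longrightarrow> c s = 0)
    \<and> x = (\<Sum>s\<in>T. c s *\<^sub>R rt s))" for x
  have "convex_cone {x. P x}"
    unfolding convex_cone_iff mem_Collect_eq
  proof (intro conjI ballI allI impI)
    show "P 0" unfolding P_def by (rule exI [of _ "{}"], rule exI [of _ "\<lambda>_. 0"]) auto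
  next
    fix x y assume "x \<in> {x. P x}" "y \<in> {x. P x}"
    then obtain T c T' c' where
      T: "finite T" "T \<subseteq> S" "\<forall>s. c s \<ge> (0::real)" "\<forall>s. s \<notin> T \<longrightarrow> c s = 0" "x = (\<Sum>s\<in>T. c s *\<^sub>R rt s)"
      and T': "finite T'" "T' \<subseteq> S" "\<forall>s. c' s \<ge> (0::real)" "\<forall>s. s \<notin> T' \<longrightarrow> c' s = 0"
        "y = (\<Sum>s\<in>T'. c' s *\<^sub>R rt s)"
      unfolding P_def by auto
    have "x = (\<Sum>s\<in>T \<union> T'. c s *\<^sub>R rt s)" "y = (\<Sum>s\<in>T \<union> T'. c' s *\<^sub>R rt s)"
      unfolding T(5) T'(5) using T T' by (intro sum.mono_neutral_left; auto)+
    then have "x + y = (\<Sum>s\<in>T \<union> T'. (c s + c' s) *\<^sub>R rt s)"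
      by (simp add: scaleR_add_left sum.distrib)
    then show "P (x + y)" unfolding P_def
      using T T' by (intro exI [of _ "T \<union> T'"] exI [of _ "\<lambda>s. c s + c' s"]) auto
  next
    fix x and a :: real assume "x \<in> {x. P x}" "0 \<le> a"
    then obtain T c where
      T: "finite T" "T \<subseteq> S" "\<forall>s. c s \<ge> (0::real)" "\<forall>s. s \<notin> T \<longrightarrow> c s = 0" "x = (\<Sum>s\<in>T. c s *\<^sub>R rt s)"
      unfolding P_def by auto
    then show "P (a *\<^sub>R x)" unfolding P_def
      using \<open>0 \<le> a\<close> by (intro exI [of _ T] exI [of _ "\<lambda>s. a * c s"]) (auto simp: scaleR_sum_right)
  qed
  moreover have "rt ` S \<subseteq> {x. P x}"
  proof
    fix x assume "x \<in> rt ` S"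
    then obtain s where "s \<in> S" "x = rt s" by auto
    then show "x \<in> {x. P x}" unfolding P_def mem_Collect_eq
      by (intro exI [of _ "{s}"] exI [of _ "\<lambda>t. if t = s then 1 else 0"]) auto
  qed
  ultimately have "cone \<subseteq> {x. P x}" unfolding cone_def by (rule hull_minimal [rotated])
  then show ?thesis using that assms unfolding P_def by blast
qed

text \<open>Adding representations of \<open>x\<close> and \<open>- x\<close> gives a nonnegative
  relation among simple roots, which positive independence makes trivial.\<close>

lemma cone_pointed:
  assumes "x \<in> cone" "- x \<in> cone" shows "x = 0"
proof -
  obtain T c where T: "finite T" "T \<subseteq> S" "\<And>s. c s \<ge> (0::real)" "\<And>s. s \<notin> T \<Longrightarrow> c s = 0"
    "x = (\<Sum>s\<in>T. c s *\<^sub>R rt s)" using cone_combination [OF assms(1)] by metis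
  obtain T' c' where T': "finite T'" "T' \<subseteq> S" "\<And>s. c' s \<ge> (0::real)" "\<And>s. s \<notin> T' \<Longrightarrow> c' s = 0"
    "- x = (\<Sum>s\<in>T'. c' s *\<^sub>R rt s)" using cone_combination [OF assms(2)] by metis
  have "x = (\<Sum>s\<in>T \<union> T'. c s *\<^sub>R rt s)"
    unfolding T(5) using T(1,2,4) T'(1,2,4) by (intro sum.mono_neutral_left) auto
  moreover have "- x = (\<Sum>s\<in>T \<union> T'. c' s *\<^sub>R rt s)"
    unfolding T'(5) using T(1,2,4) T'(1,2,4) by (intro sum.mono_neutral_left) auto
  ultimately have "(\<Sum>s\<in>T \<union> T'. (c s + c' s) *\<^sub>R rt s) = x + - x"
    by (simp add: scaleR_add_left sum.distrib)
  then have sum0: "(\<Sum>s\<in>T \<union> T'. (c s + c' s) *\<^sub>R rt s) = 0" by simp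
  have "c s = 0" if "s \<in> T" for s
  proof -
    have "c s + c' s = 0"
      by (rule positively_independent [OF _ _ _ sum0]) (use T(1-3) T'(1-3) that in auto)
    then show ?thesis using T(3) [of s] T'(3) [of s] by linarith
  qed
  then show ?thesis using T(5) by simp
qed

section \<open>Dihedral subgroups\<close>

definition unit_root :: "'w \<Rightarrow> 'v" where
  "unit_root s = (1 / sqrt (B (rt s) (rt s))) *\<^sub>R rt s"

lemma B_unit_root: "s \<in> S \<Longrightarrow> t \<in> S \<Longrightarrow>
    B (unit_root s) (unit_root t) = B (rt s) (rt t) / (sqrt (B (rt s) (rt s) * B (rt t) (rt t)))"
  by (simp add: unit_root_def B_simps real_sqrt_mult)

lemma act_unit_root:
  assumes "s \<in> S" "t \<in> S"
  shows "act t (unit_root s) = unit_root s - (2 * B (unit_root s) (unit_root t)) *\<^sub>R unit_root t"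
proof -
  have "sqrt (B (rt t) (rt t)) * sqrt (B (rt t) (rt t)) = B (rt t) (rt t)"
    using B_gen_pos [OF assms(2)] by simp
  then show ?thesis
    by (simp add: act_gen assms unit_root_def B_simps)
qed

text \<open>After normalisation the pair is described by the single number \<open>c\<close>.
  Reflecting in \<open>z\<close> keeps the coefficient of the other root and replaces that of
  \<open>z\<close> by \<open>2 * c\<close> times the other coefficient minus the old one, which is
  the Chebyshev recurrence.\<close>

lemma dihedral_unit_root:
  fixes s t
  defines "c \<equiv> - B (unit_root s) (unit_root t)"
  assumes st: "s \<in> S" "t \<in> S"
  shows "act (wp (alternating_word n s t)) (unit_root s) =
    chebyshev_U c (Suc n) *\<^sub>R unit_root (if even n then s else t)
    + chebyshev_U c n *\<^sub>R unit_root (if even n then t else s)"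
proof (induction n)
  case (Suc n)
  define z where "z = (if even n then t else s)"
  define z' where "z' = (if even n then s else t)"
  have z: "z \<in> S" "z' \<in> S" using st by (auto simp: z_def z'_def)
  have "wp (alternating_word n s t) \<in> carrier W"
    using st set_alternating_word [of n s t] by (intro word_closed) auto
  then have "act (wp (alternating_word (Suc n) s t)) (unit_root s) =
      act z (act (wp (alternating_word n s t)) (unit_root s))"
    using z by (simp add: act_mult z_def)
  also have "\<dots> = act z (chebyshev_U c (Suc n) *\<^sub>R unit_root z' + chebyshev_U c n *\<^sub>R unit_root z)"
    using Suc by (simp add: z_def z'_def)
  also have "\<dots> = chebyshev_U c (Suc n) *\<^sub>R act z (unit_root z') + chebyshev_U c n *\<^sub>R act z (unit_root z)"
    using z by (simp add: act_add act_scaleR)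
  also have "act z (unit_root z) = - unit_root z"
    using z by (simp add: unit_root_def act_scaleR act_gen_root)
  also have "act z (unit_root z') = unit_root z' + (2 * c) *\<^sub>R unit_root z"
    using act_unit_root [OF z(2,1)] B_commute [of "unit_root s" "unit_root t"]
    by (auto simp: c_def z_def z'_def)
  finally have "act (wp (alternating_word (Suc n) s t)) (unit_root s) =
      chebyshev_U c (Suc (Suc n)) *\<^sub>R unit_root z + chebyshev_U c (Suc n) *\<^sub>R unit_root z'"
    by (simp add: algebra_simps del: alternating_word.simps)
  moreover have "(if even (Suc n) then s else t) = z" "(if even (Suc n) then t else s) = z'"
    by (auto simp: z_def z'_def)
  ultimately show ?case by (simp only:)
qed simp

lemma dihedral_nonneg:
  assumes "s \<in> S" "t \<in> S" "s \<noteq> t" "m s t = 0 \<or> n \<le> m s t"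
  shows "chebyshev_U (- B (unit_root s) (unit_root t)) n \<ge> 0"
proof -
  have pos: "sqrt (B (rt s) (rt s) * B (rt t) (rt t)) > 0"
    using B_gen_pos assms by simp
  show ?thesis
  proof (cases "m s t = 0")
    case True
    then have "B (rt s) (rt t) \<le> - sqrt (B (rt s) (rt s) * B (rt t) (rt t))"
      using assms by (intro B_gens_infinite)
    then have "- B (unit_root s) (unit_root t) \<ge> 1"
      using pos assms by (simp add: B_unit_root pos_divide_le_eq)
    then show ?thesis using chebyshev_U_mono by blast
  next
    case False
    define q where "q = sqrt (B (rt s) (rt s) * B (rt t) (rt t))"
    have "B (unit_root s) (unit_root t) = - q * cos (pi / real (m s t)) / q"
      unfolding B_unit_root [OF assms(1,2)] q_def B_gens [OF assms(1,2) False] ..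
    then have "- B (unit_root s) (unit_root t) = cos (pi / real (m s t))"
      using pos by (simp add: q_def [symmetric])
    moreover have "2 \<le> m s t"
      using False m_eq_1_iff [of s t] assms by linarith
    ultimately show ?thesis using chebyshev_U_nonneg_cos [of "m s t" n] False assms by simp
  qed
qed

text \<open>By the braid relation the last \<open>m s t\<close> letters can be exchanged for the
  alternating word ending in \<open>s\<close>, and that \<open>s\<close> cancels.\<close>

lemma len_alternating_gen_less:
  assumes st: "s \<in> S" "t \<in> S" and "m s t \<noteq> 0" "m s t \<le> k"
  shows "len (wp (alternating_word k s t) \<bullet> s) < k"
proof -
  obtain p where p: "alternating_word k s t = p @ alternating_word (m s t) s t" "set p \<subseteq> {s, t}"
    using alternating_word_suffix [OF assms(4), of s t] by auto
  obtain n where n: "m s t = Suc n" using assms(3) by (cases "m s t") auto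
  define q where "q = alternating_word n s t"
  have sub: "set p \<subseteq> S" "set q \<subseteq> S" "set (alternating_word (m s t) s t) \<subseteq> S"
    using p(2) st set_alternating_word [of n s t] set_alternating_word [of "m s t" s t]
    unfolding q_def by blast+
  have "wp (alternating_word (m s t) s t) = wp (q @ [s])"
    unfolding alternating_word_braid [OF st] unfolding n alternating_word_snoc q_def ..
  then have "wp (alternating_word k s t) = wp p \<bullet> (wp q \<bullet> s)"
    unfolding p(1) using sub st by (simp add: word_append)
  then have "wp (alternating_word k s t) \<bullet> s = wp (p @ q)"
    using sub st by (simp add: word_append W.m_assoc)
  then have "len (wp (alternating_word k s t) \<bullet> s) \<le> length (p @ q)"
    using sub len_le [of "p @ q"] by simp
  moreover have "k = length p + Suc n"
    using arg_cong [OF p(1), of length] n by simp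
  ultimately show ?thesis by (simp add: q_def)
qed

text \<open>
  Split off from \<open>w\<close> the longest possible alternating word in \<open>s\<close> and \<open>t\<close>, where \<open>t\<close> is the last letter of
  a reduced word of \<open>w\<close>. The remaining factor \<open>v\<close> is lengthened by both \<open>s\<close> and \<open>t\<close>, so the induction
  hypothesis applies to it, and the alternating word sends \<open>\<alpha>\<^sub>s\<close> to a nonnegative combination of \<open>\<alpha>\<^sub>s\<close>
  and \<open>\<alpha>\<^sub>t\<close>.
\<close>

theorem act_root_positive:
  assumes "w \<in> carrier W" "s \<in> S" "len w < len (w \<bullet> s)"
  shows "act w (rt s) \<in> cone"
  using assms
proof (induction "len w" arbitrary: w s rule: less_induct)
  case less
  show ?case
  proof (cases "w = \<one>\<^bsub>W\<^esub>")
    case True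
    then show ?thesis using less.prems by (simp add: cone_gen)
  next
    case False
    obtain u where u: "set u \<subseteq> S" "wp u = w" "length u = len w"
      using len_word less.prems(1) by blast
    with False have "u \<noteq> []" by auto
    then obtain u' t where ut: "u = u' @ [t]" by (metis rev_exhaust)
    have t: "t \<in> S" and u': "set u' \<subseteq> S" using u ut by auto
    have wt: "w = wp u' \<bullet> t" using u t u' ut by (simp add: word_append)
    have lu': "len (wp u') = len w - 1"
    proof -
      have "len (wp u') \<le> length u'" using u' by (rule len_le)
      moreover have "len w \<le> len (wp u') + 1"
        using len_mult_le [of "wp u'" t] len_gen [OF t] u' t wt by simp
      ultimately show ?thesis using u ut by simp
    qed
    have "t \<noteq> s"
      using less.prems wt u' lu' by auto
    let ?a = "\<lambda>k. wp (alternating_word k s t)"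
    have a: "?a k \<in> carrier W" for k
      using less.prems t set_alternating_word [of k s t] by (intro word_closed) auto
    have len_a: "len (?a k) \<le> k" for k
      using len_le [of "alternating_word k s t"] t less.prems set_alternating_word [of k s t] by auto
    \<comment> \<open>\<open>P k\<close>: an alternating word of length \<open>k\<close> ending in
      \<open>t\<close> splits off from the right of \<open>w\<close> without loss of length.
      \<open>P 1\<close> holds by the choice of \<open>t\<close>, so the maximal \<open>k\<close> is
      positive and \<open>v\<close> is shorter than \<open>w\<close>.\<close>
    define P where "P k \<longleftrightarrow> (\<exists>v \<in> carrier W. w = v \<bullet> ?a k \<and> len w = len v + k)" for k
    have "P 1"
      unfolding P_def using wt u' t lu' u ut by (intro bexI [of _ "wp u'"]) auto
    moreover have "\<forall>k. P k \<longrightarrow> k \<le> len w" by (auto simp: P_def)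
    ultimately have "P (Greatest P)" "1 \<le> Greatest P" "\<And>k. P k \<Longrightarrow> k \<le> Greatest P"
      using GreatestI_nat [of P 1 "len w"] Greatest_le_nat [of P _ "len w"] by blast+
    then obtain k where k: "P k" "\<And>k'. P k' \<Longrightarrow> k' \<le> k" "1 \<le> k"
      by blast
    then obtain v where v: "v \<in> carrier W" "w = v \<bullet> ?a k" "len w = len v + k"
      by (auto simp: P_def)
    define z where "z = (if even k then t else s)"
    define z' where "z' = (if even k then s else t)"
    have z: "z \<in> S" "z' \<in> S" using t less.prems by (auto simp: z_def z'_def)
    have "len v < len (v \<bullet> z)"
    proof (rule ccontr)
      assume "\<not> ?thesis"
      then have lt: "len (v \<bullet> z) < len v"
        using len_gen_neq [of v z] v z by linarith
      have "w = (v \<bullet> z) \<bullet> ?a (Suc k)"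
        using v z a by (simp add: W.m_assoc z_def [symmetric])
      moreover from this have "len w \<le> len (v \<bullet> z) + Suc k"
        using len_mult_le [of "v \<bullet> z" "?a (Suc k)"] len_a [of "Suc k"] v z a [of "Suc k"]
        by (simp del: alternating_word.simps)
      ultimately have "P (Suc k)"
        unfolding P_def using lt v z by (intro bexI [of _ "v \<bullet> z"]) auto
      then show False using k(2) by fastforce
    qed
    \<comment> \<open>\<open>z'\<close> is the first letter of \<open>?a k\<close>. If it shortened
      \<open>v\<close>, moving it from \<open>?a k\<close> to \<open>v\<close> would shorten both
      factors, contradicting \<open>len w = len v + k\<close>.\<close>
    moreover have "len v < len (v \<bullet> z')"
    proof (rule ccontr)
      assume "\<not> ?thesis"
      then have lt: "len (v \<bullet> z') < len v"
        using len_gen_neq [of v z'] v z by linarith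
      obtain k' where k': "k = Suc k'" using k by (cases k) auto
      have "?a k = z' \<bullet> ?a k'" by (simp add: k' z'_def)
      then have "w = (v \<bullet> z') \<bullet> ?a k'"
        using v z a by (simp add: W.m_assoc)
      then have "len w \<le> len (v \<bullet> z') + len (?a k')"
        using len_mult_le [of "v \<bullet> z'" "?a k'"] v z a by simp
      then show False using len_a [of k'] lt v k' by simp
    qed
    ultimately have "act v (rt z) \<in> cone" "act v (rt z') \<in> cone"
      using less.hyps [of v] v z k by auto
    then have vst: "act v (rt s) \<in> cone" "act v (rt t) \<in> cone"
      by (auto simp: z_def z'_def split: if_splits)
    \<comment> \<open>The coefficients used below have indices \<open>k\<close> and
      \<open>k + 1\<close>, so nonnegativity asks for \<open>k + 1\<close> at most
      \<open>m s t\<close>. For larger \<open>k\<close> the generator \<open>s\<close> would shorten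
      \<open>w\<close>.\<close>
    have "m s t = 0 \<or> k < m s t"
    proof (rule ccontr)
      assume "\<not> ?thesis"
      then have "len (?a k \<bullet> s) < k"
        using less.prems t by (intro len_alternating_gen_less) auto
      moreover have "len (w \<bullet> s) \<le> len v + len (?a k \<bullet> s)"
        using len_mult_le [of v "?a k \<bullet> s"] v a less.prems by (simp add: W.m_assoc)
      ultimately show False using v less.prems by simp
    qed
    then have nonneg: "chebyshev_U (- B (unit_root s) (unit_root t)) k \<ge> 0"
        "chebyshev_U (- B (unit_root s) (unit_root t)) (Suc k) \<ge> 0"
      using dihedral_nonneg [of s t] less.prems t \<open>t \<noteq> s\<close> by auto
    have unit: "act v (unit_root r) \<in> cone" if "r \<in> {s, t}" for r
    proof -
      have "B (rt r) (rt r) > 0" using that t less.prems by (auto simp: B_gen_pos)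
      then show ?thesis
        using that vst v unfolding unit_root_def by (auto simp: act_scaleR intro!: cone_scaleR)
    qed
    have "act w (unit_root s) = act v (act (?a k) (unit_root s))"
      using v a by (simp add: act_mult)
    also have "\<dots> \<in> cone"
      using v nonneg unit
      by (auto simp: dihedral_unit_root less.prems t act_add act_scaleR intro!: cone_add cone_scaleR)
    finally have "act w (unit_root s) \<in> cone" .
    then show ?thesis
      using B_gen_pos [OF less.prems(2)] less.prems(1)
      by (simp add: unit_root_def act_scaleR cone_scaleR_iff)
  qed
qed

section \<open>Roots and reflections\<close>

lemma word_rev: "set u \<subseteq> S \<Longrightarrow> wp (rev u) = inv_W (wp u)"
  by (induction u) (auto simp: word_append W.inv_mult_group)

lemma len_inv:
  assumes "w \<in> carrier W" shows "len (inv_W w) = len w"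
proof -
  have "len (inv_W w) \<le> len w" if w: "w \<in> carrier W" for w
  proof -
    obtain u where "set u \<subseteq> S" "wp u = w" "length u = len w" using len_word w by blast
    then show ?thesis using word_rev [of u] len_le [of "rev u"] by simp
  qed
  from this [of w] this [of "inv_W w"] show ?thesis using assms by simp
qed

lemma root_nonzero: "\<gamma> \<in> roots R \<Longrightarrow> B \<gamma> \<gamma> > 0"
  unfolding roots_def using B_gen_pos B_invariant by auto

lemma roots_act: "w \<in> carrier W \<Longrightarrow> \<gamma> \<in> roots R \<Longrightarrow> act w \<gamma> \<in> roots R"
  unfolding roots_def by (fastforce simp flip: act_mult)

lemma roots_gen: "s \<in> S \<Longrightarrow> rt s \<in> roots R"
  unfolding roots_def mem_Collect_eq by (intro exI [of _ "\<one>\<^bsub>W\<^esub>"] exI [of _ s]) auto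

lemma rootsE:
  assumes "\<gamma> \<in> roots R"
  obtains w s where "w \<in> carrier W" "s \<in> S" "\<gamma> = act w (rt s)"
  using assms unfolding roots_def by auto

lemma act_root_negative:
  assumes "w \<in> carrier W" "s \<in> S" "len (w \<bullet> s) < len w"
  shows "- act w (rt s) \<in> cone"
proof -
  have "act (w \<bullet> s) (rt s) \<in> cone"
    using assms by (intro act_root_positive) auto
  then show ?thesis using assms by (simp add: act_mult act_gen_root act_minus)
qed

lemma pos_roots_eq: "pos_roots R = roots R \<inter> cone"
  by (simp add: pos_roots_def cone_def)

lemma roots_minus:
  assumes "\<gamma> \<in> roots R" shows "- \<gamma> \<in> roots R"
proof -
  obtain w s where w: "w \<in> carrier W" "s \<in> S" "\<gamma> = act w (rt s)" by (rule rootsE [OF assms])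
  then have "- \<gamma> = act (w \<bullet> s) (rt s)" by (simp add: act_mult act_gen_root act_minus)
  then show ?thesis using w roots_act roots_gen by simp
qed

lemma root_pos_or_neg:
  assumes "\<gamma> \<in> roots R" shows "\<gamma> \<in> pos_roots R \<or> - \<gamma> \<in> pos_roots R"
proof -
  obtain w s where w: "w \<in> carrier W" "s \<in> S" "\<gamma> = act w (rt s)" by (rule rootsE [OF assms])
  then have "\<gamma> \<in> cone \<or> - \<gamma> \<in> cone"
    using act_root_positive act_root_negative len_gen_neq [of w s] by (metis linorder_neqE_nat)
  then show ?thesis using assms roots_minus by (auto simp: pos_roots_eq)
qed

lemma pos_root_not_neg:
  assumes "\<gamma> \<in> pos_roots R" shows "- \<gamma> \<notin> cone"
  using assms cone_pointed [of \<gamma>] root_nonzero [of \<gamma>]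
  by (auto simp: pos_roots_eq bilinear_lzero [OF B_bilinear])

lemma neg_root_iff: "\<gamma> \<in> roots R \<Longrightarrow> - \<gamma> \<in> pos_roots R \<longleftrightarrow> \<gamma> \<notin> pos_roots R"
  using root_pos_or_neg [of \<gamma>] pos_root_not_neg [of \<gamma>] by (auto simp: pos_roots_eq)

lemma pos_roots_gen: "s \<in> S \<Longrightarrow> rt s \<in> pos_roots R"
  by (simp add: pos_roots_eq roots_gen cone_gen)

lemma pos_roots_roots: "\<gamma> \<in> pos_roots R \<Longrightarrow> \<gamma> \<in> roots R"
  by (simp add: pos_roots_eq)

text \<open>A nontrivial element is shortened by the last letter of a reduced word, hence sends the
  root of that letter to a negative vector and cannot act trivially.\<close>

lemma act_faithful:
  assumes g: "g \<in> carrier W" and h: "h \<in> carrier W" and eq: "\<And>v. act g v = act h v"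
  shows "g = h"
proof -
  define w where "w = inv_W h \<bullet> g"
  have w: "w \<in> carrier W" using g h by (simp add: w_def)
  have triv: "act w v = v" for v using g h by (simp add: w_def act_mult eq)
  have "w = \<one>\<^bsub>W\<^esub>"
  proof (rule ccontr)
    assume "w \<noteq> \<one>\<^bsub>W\<^esub>"
    moreover obtain u where u: "set u \<subseteq> S" "wp u = w" "length u = len w" using len_word w by blast
    ultimately have "u \<noteq> []" by auto
    then obtain u' s where us: "u = u' @ [s]" by (metis rev_exhaust)
    have s: "s \<in> S" "set u' \<subseteq> S" using u us by auto
    have "w \<bullet> s = wp u'" using u us s by (auto simp: word_append)
    then have "len (w \<bullet> s) < len w" using u us len_le [OF s(2)] by simp
    then have "- rt s \<in> cone" using act_root_negative [OF w s(1)] triv by simp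
    then show False using pos_root_not_neg [OF pos_roots_gen [OF s(1)]] by simp
  qed
  then show ?thesis
    using g h unfolding w_def by (metis W.inv_equality W.inv_inv W.inv_closed)
qed

lemma act_conjugate_gen:
  assumes "w \<in> carrier W" "s \<in> S"
  defines "\<gamma> \<equiv> act w (rt s)"
  shows "act (w \<bullet> s \<bullet> inv_W w) v = v - (2 * B v \<gamma> / B \<gamma> \<gamma>) *\<^sub>R \<gamma>"
proof -
  have "B (act (inv_W w) v) (rt s) = B v \<gamma>"
    unfolding \<gamma>_def using B_invariant [of w "act (inv_W w) v" "rt s"] assms by simp
  moreover have "B \<gamma> \<gamma> = B (rt s) (rt s)"
    unfolding \<gamma>_def using assms by (simp add: B_invariant)
  ultimately show ?thesis
    using assms(1,2) by (simp add: act_mult act_gen act_diff act_scaleR \<gamma>_def)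
qed

text \<open>The reflection formula does not change when the root is rescaled, so faithfulness
  identifies the group elements. With \<open>c = 1\<close> this makes the description in
  \<open>root_reflection\<close> unique.\<close>

lemma conjugate_gen_eqI:
  assumes w: "w \<in> carrier W" "s \<in> S" and w': "w' \<in> carrier W" "s' \<in> S"
    and eq: "act w' (rt s') = c *\<^sub>R act w (rt s)"
  shows "w' \<bullet> s' \<bullet> inv_W w' = w \<bullet> s \<bullet> inv_W w"
proof (rule act_faithful)
  fix v
  have "B (act w' (rt s')) (act w' (rt s')) > 0"
    using w' by (simp add: B_invariant B_gen_pos)
  then have "c \<noteq> 0" unfolding eq by (auto simp: bilinear_lzero [OF B_bilinear])
  then show "act (w' \<bullet> s' \<bullet> inv_W w') v = act (w \<bullet> s \<bullet> inv_W w) v"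
    unfolding act_conjugate_gen [OF w] act_conjugate_gen [OF w'] eq
    by (simp add: B_simps)
qed (use assms in auto)

abbreviation "reflect \<equiv> root_reflection R"

lemma root_reflection_act_gen:
  assumes "w \<in> carrier W" "s \<in> S"
  shows "reflect (act w (rt s)) = w \<bullet> s \<bullet> inv_W w"
  unfolding root_reflection_def
proof (rule the_equality)
  fix t assume "\<exists>w'\<in>carrier W. \<exists>s'\<in>S. act w (rt s) = act w' (rt s') \<and> t = w' \<bullet> s' \<bullet> inv_W w'"
  then obtain w' s' where "w' \<in> carrier W" "s' \<in> S" "act w (rt s) = act w' (rt s')"
    "t = w' \<bullet> s' \<bullet> inv_W w'" by blast
  then show "t = w \<bullet> s \<bullet> inv_W w"
    using conjugate_gen_eqI [of w s w' s' 1] assms by simp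
qed (use assms in blast)

lemma root_reflection_gen [simp]: "s \<in> S \<Longrightarrow> reflect (rt s) = s"
  using root_reflection_act_gen [of "\<one>\<^bsub>W\<^esub>" s] by simp

lemma root_reflection_act:
  assumes "w \<in> carrier W" "\<gamma> \<in> roots R"
  shows "reflect (act w \<gamma>) = w \<bullet> reflect \<gamma> \<bullet> inv_W w"
proof -
  obtain x s where x: "x \<in> carrier W" "s \<in> S" "\<gamma> = act x (rt s)" by (rule rootsE [OF assms(2)])
  then have "reflect (act w \<gamma>) = reflect (act (w \<bullet> x) (rt s))" using assms by (simp add: act_mult)
  also have "\<dots> = w \<bullet> reflect \<gamma> \<bullet> inv_W w"
    using x assms(1)
    by (simp add: root_reflection_act_gen W.inv_mult_group W.m_assoc del: root_reflection_gen)
  finally show ?thesis .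
qed

lemma refl_closed [simp]: "\<gamma> \<in> roots R \<Longrightarrow> reflect \<gamma> \<in> carrier W"
  by (erule rootsE) (simp add: root_reflection_act_gen)

lemma act_refl: "\<gamma> \<in> roots R \<Longrightarrow> act (reflect \<gamma>) v = v - (2 * B v \<gamma> / B \<gamma> \<gamma>) *\<^sub>R \<gamma>"
  by (erule rootsE) (simp add: root_reflection_act_gen act_conjugate_gen)

lemma act_refl_root: "\<gamma> \<in> roots R \<Longrightarrow> act (reflect \<gamma>) \<gamma> = - \<gamma>"
  using root_nonzero [of \<gamma>] by (simp add: act_refl scaleR_2)

lemma refl_square:
  assumes "\<gamma> \<in> roots R" shows "reflect \<gamma> \<bullet> reflect \<gamma> = \<one>\<^bsub>W\<^esub>"
proof -
  obtain w s where w: "w \<in> carrier W" "s \<in> S" "\<gamma> = act w (rt s)" by (rule rootsE [OF assms])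
  have "(w \<bullet> s \<bullet> inv_W w) \<bullet> (w \<bullet> s \<bullet> inv_W w) = w \<bullet> (s \<bullet> ((inv_W w \<bullet> w) \<bullet> (s \<bullet> inv_W w)))"
    using w by (simp only: W.m_assoc W.m_closed W.inv_closed gens_closed)
  also have "\<dots> = \<one>\<^bsub>W\<^esub>" using w by simp
  finally show ?thesis using w by (simp add: root_reflection_act_gen)
qed

lemma refl_inv: "\<gamma> \<in> roots R \<Longrightarrow> inv_W (reflect \<gamma>) = reflect \<gamma>"
  by (simp add: W.inv_equality refl_square)

lemma act_refl_refl [simp]: "\<gamma> \<in> roots R \<Longrightarrow> act (reflect \<gamma>) (act (reflect \<gamma>) v) = v"
  by (metis act_act_inv refl_closed refl_inv)

text \<open>Equal reflections make the two roots proportional. They also make the underlying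
  generators conjugate, so the roots have the same norm and the factor is 1 or -1; positivity
  excludes -1.\<close>

lemma refl_inj:
  assumes "\<gamma> \<in> pos_roots R" "\<delta> \<in> pos_roots R" "reflect \<gamma> = reflect \<delta>"
  shows "\<gamma> = \<delta>"
proof -
  note r = pos_roots_roots [OF assms(1)] pos_roots_roots [OF assms(2)]
  obtain w s where w: "w \<in> carrier W" "s \<in> S" "\<gamma> = act w (rt s)" by (rule rootsE [OF r(1)])
  obtain x t where x: "x \<in> carrier W" "t \<in> S" "\<delta> = act x (rt t)" by (rule rootsE [OF r(2)])
  have "w \<bullet> s \<bullet> inv_W w = x \<bullet> t \<bullet> inv_W x"
    using assms(3) w x by (simp add: root_reflection_act_gen)
  then have "inv_W w \<bullet> (w \<bullet> s \<bullet> inv_W w) \<bullet> w = inv_W w \<bullet> (x \<bullet> t \<bullet> inv_W x) \<bullet> w" by simp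
  moreover have "inv_W w \<bullet> (w \<bullet> s \<bullet> inv_W w) \<bullet> w = (inv_W w \<bullet> w) \<bullet> s \<bullet> (inv_W w \<bullet> w)"
    using w by (simp only: W.m_assoc W.m_closed W.inv_closed gens_closed)
  ultimately have "s = inv_W w \<bullet> (x \<bullet> t \<bullet> inv_W x) \<bullet> w"
    using w by simp
  then have "s = (inv_W w \<bullet> x) \<bullet> t \<bullet> inv_W (inv_W w \<bullet> x)"
    using w x by (simp add: W.inv_mult_group W.m_assoc)
  then have "B (rt s) (rt s) = B (rt t) (rt t)"
    using w x by (intro B_conjugate [of s t "inv_W w \<bullet> x"]) auto
  then have N: "B \<gamma> \<gamma> = B \<delta> \<delta>" using w x by (simp add: B_invariant)
  define c where "c = B \<gamma> \<delta> / B \<delta> \<delta>"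
  have "- \<gamma> = \<gamma> - (2 * c) *\<^sub>R \<delta>"
    using act_refl_root [OF r(1)] act_refl [OF r(2), of \<gamma>] assms(3) by (simp add: c_def)
  then have "2 *\<^sub>R \<gamma> = 2 *\<^sub>R (c *\<^sub>R \<delta>)" by (simp add: scaleR_2 algebra_simps)
  then have c: "\<gamma> = c *\<^sub>R \<delta>" by (simp only: scaleR_cancel_left) simp
  then have "c * c * B \<delta> \<delta> = B \<delta> \<delta>" using N by (simp add: B_simps)
  then have "c * c = 1" using root_nonzero [OF r(2)] by simp
  then have "c = 1 \<or> c = -1" by (simp add: square_eq_1_iff)
  moreover have "c \<noteq> -1"
    using c pos_root_not_neg [OF assms(1)] assms(2) by (auto simp: pos_roots_eq)
  ultimately show ?thesis using c by simp
qed

lemma pos_roots_proportional: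
  assumes "\<gamma> \<in> pos_roots R" "\<delta> \<in> pos_roots R" "\<gamma> = c *\<^sub>R \<delta>"
  shows "\<gamma> = \<delta>"
proof (rule refl_inj [OF assms(1,2)])
  note r = pos_roots_roots [OF assms(1)] pos_roots_roots [OF assms(2)]
  obtain w s where w: "w \<in> carrier W" "s \<in> S" "\<gamma> = act w (rt s)" by (rule rootsE [OF r(1)])
  obtain x t where x: "x \<in> carrier W" "t \<in> S" "\<delta> = act x (rt t)" by (rule rootsE [OF r(2)])
  show "reflect \<gamma> = reflect \<delta>"
    unfolding w(3) x(3) root_reflection_act_gen [OF w(1,2)] root_reflection_act_gen [OF x(1,2)]
    using assms(3) w(3) x(3) by (intro conjugate_gen_eqI [OF x(1,2) w(1,2), of c]) simp
qed

section \<open>Extremality of the simple roots\<close>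

lemma B_gens_nonpos:
  assumes "s \<in> S" "t \<in> S" "s \<noteq> t" shows "B (rt s) (rt t) \<le> 0"
proof -
  have q: "sqrt (B (rt s) (rt s) * B (rt t) (rt t)) \<ge> 0" using B_gen_pos assms by (simp add: less_imp_le)
  show ?thesis
  proof (cases "m s t = 0")
    case True
    then show ?thesis using B_gens_infinite assms q by (smt (verit))
  next
    case False
    then have "2 \<le> m s t" using m_eq_1_iff [of s t] assms by linarith
    then have "0 \<le> pi / real (m s t)" "pi / real (m s t) \<le> pi / 2" by (auto simp: divide_simps)
    then have "cos (pi / real (m s t)) \<ge> 0" by (intro cos_ge_zero) linarith+
    then show ?thesis unfolding B_gens [OF assms(1,2) False] using q by simp
  qed
qed

text \<open>
  Stands in for linear independence of the simple roots. A relation that expresses a positive multiple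
  of \<open>\<alpha>\<^sub>s\<close> through the other simple roots is excluded by pairing it with \<open>\<alpha>\<^sub>s\<close>.
\<close>

lemma gen_extremal:
  assumes s: "s \<in> S" and x: "x \<in> cone" and y: "y \<in> cone" and eq: "a *\<^sub>R rt s = x + y"
  shows "\<exists>c. x = c *\<^sub>R rt s"
proof -
  obtain T c where T: "finite T" "T \<subseteq> S" "\<And>s. c s \<ge> (0::real)" "\<And>s. s \<notin> T \<Longrightarrow> c s = 0"
    "x = (\<Sum>s\<in>T. c s *\<^sub>R rt s)" using cone_combination [OF x] by metis
  obtain T' c' where T': "finite T'" "T' \<subseteq> S" "\<And>s. c' s \<ge> (0::real)" "\<And>s. s \<notin> T' \<Longrightarrow> c' s = 0"
    "y = (\<Sum>s\<in>T'. c' s *\<^sub>R rt s)" using cone_combination [OF y] by metis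
  define U where "U = (T \<union> T') - {s}"
  define e where "e t = c t + c' t" for t
  have U: "finite U" "U \<subseteq> S" "s \<notin> U" using T(1,2) T'(1,2) by (auto simp: U_def)
  have split: "(\<Sum>t\<in>V. f t *\<^sub>R rt t) = f s *\<^sub>R rt s + (\<Sum>t\<in>U. f t *\<^sub>R rt t)"
    if "V \<subseteq> insert s U" "\<And>t. t \<notin> V \<Longrightarrow> f t = 0" for f V
  proof -
    have "(\<Sum>t\<in>V. f t *\<^sub>R rt t) = (\<Sum>t\<in>insert s U. f t *\<^sub>R rt t)"
      using that U by (intro sum.mono_neutral_left) auto
    then show ?thesis using U by simp
  qed
  have x: "x = c s *\<^sub>R rt s + (\<Sum>t\<in>U. c t *\<^sub>R rt t)"
    unfolding T(5) by (rule split) (use T(4) in \<open>auto simp: U_def\<close>)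
  have "y = c' s *\<^sub>R rt s + (\<Sum>t\<in>U. c' t *\<^sub>R rt t)"
    unfolding T'(5) by (rule split) (use T'(4) in \<open>auto simp: U_def\<close>)
  with x eq have k: "(a - e s) *\<^sub>R rt s = (\<Sum>t\<in>U. e t *\<^sub>R rt t)"
    by (simp add: e_def scaleR_add_left scaleR_diff_left sum.distrib algebra_simps)
  have e: "e t \<ge> 0" for t using T(3) T'(3) by (simp add: e_def)
  have "(a - e s) * B (rt s) (rt s) = B (\<Sum>t\<in>U. e t *\<^sub>R rt t) (rt s)"
    unfolding k [symmetric] by (simp add: B_simps)
  also have "\<dots> = (\<Sum>t\<in>U. e t * B (rt t) (rt s))"
  proof -
    have lin: "linear (\<lambda>x. B x (rt s))" using B_bilinear by (simp add: bilinear_def)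
    show ?thesis by (simp add: linear_sum [OF lin] B_simps)
  qed
  also have "\<dots> \<le> 0"
    using e B_gens_nonpos s U by (intro sum_nonpos mult_nonneg_nonpos) auto
  finally have "a - e s \<le> 0" using B_gen_pos [OF s] by (simp add: mult_le_0_iff)
  \<comment> \<open>The coefficient \<open>a - e s\<close> is now known to be nonpositive, so with
    all terms moved to one side the relation is nonnegative and positive independence applies. From
    \<open>e t = 0\<close> both summands \<open>c t\<close> and \<open>c' t\<close> vanish.\<close>
  define f where "f t = (if t = s then e s - a else e t)" for t
  have "(\<Sum>t\<in>insert s U. f t *\<^sub>R rt t) = (e s - a) *\<^sub>R rt s + (\<Sum>t\<in>U. e t *\<^sub>R rt t)"
  proof -
    have "(\<Sum>t\<in>U. f t *\<^sub>R rt t) = (\<Sum>t\<in>U. e t *\<^sub>R rt t)"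
      using U by (intro sum.cong) (auto simp: f_def)
    then show ?thesis using U by (simp add: f_def)
  qed
  also have "\<dots> = 0" unfolding k [symmetric] by (simp add: scaleR_diff_left)
  finally have f0: "(\<Sum>t\<in>insert s U. f t *\<^sub>R rt t) = 0" .
  have "c t = 0" if "t \<in> U" for t
  proof -
    have "f t = 0"
      by (rule positively_independent [OF _ _ _ f0])
        (use U s e \<open>a - e s \<le> 0\<close> that in \<open>auto simp: f_def\<close>)
    then show ?thesis using that U T(3) [of t] T'(3) [of t] by (auto simp: f_def e_def split: if_splits)
  qed
  then show ?thesis using x by auto
qed

text \<open>If \<open>act s \<gamma>\<close> were negative, a multiple of \<open>rt s\<close> would
  be the sum of the cone elements \<open>\<gamma>\<close> and \<open>- act s \<gamma>\<close>.
  Extremality then makes \<open>\<gamma>\<close> proportional, hence equal, to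
  \<open>rt s\<close>.\<close>

lemma act_gen_pos_root:
  assumes s: "s \<in> S" and \<gamma>: "\<gamma> \<in> pos_roots R" "\<gamma> \<noteq> rt s"
  shows "act s \<gamma> \<in> pos_roots R"
proof (rule ccontr)
  assume "act s \<gamma> \<notin> pos_roots R"
  then have "- act s \<gamma> \<in> cone"
    using neg_root_iff [of "act s \<gamma>"] roots_act s \<gamma> by (auto simp: pos_roots_eq)
  moreover have "\<gamma> \<in> cone" using \<gamma> by (simp add: pos_roots_eq)
  moreover have "(2 * B \<gamma> (rt s) / B (rt s) (rt s)) *\<^sub>R rt s = \<gamma> + - act s \<gamma>"
    using s by (simp add: act_gen)
  ultimately obtain c where "\<gamma> = c *\<^sub>R rt s" using gen_extremal [OF s] by metis
  then show False using pos_roots_proportional \<gamma> pos_roots_gen s by blast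
qed

lemma convex_cone_vimage_act:
  assumes "w \<in> carrier W" "convex_cone K" shows "convex_cone {v. act w v \<in> K}"
  unfolding convex_cone_iff
  using assms
  by (auto simp: act_add act_scaleR act_zero convex_cone_add convex_cone_scaleR convex_cone_contains_0)

text \<open>The generator \<open>s\<close> maps every other positive root into the cone, hence also
  their conic combinations, but it negates \<open>rt s\<close>.\<close>

lemma gen_not_in_cone_of_others:
  assumes "s \<in> S" shows "rt s \<notin> convex_cone hull (pos_roots R - {rt s})"
proof
  assume "rt s \<in> convex_cone hull (pos_roots R - {rt s})"
  also have "\<dots> \<subseteq> {v. act s v \<in> cone}"
    using assms act_gen_pos_root [OF assms]
    by (intro hull_minimal convex_cone_vimage_act cone_convex_cone) (auto simp: pos_roots_eq)
  finally show False
    using pos_root_not_neg [OF pos_roots_gen [OF assms]] assms by (simp add: act_gen_root)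
qed

section \<open>Signs of roots along reduced words\<close>

lemma reduced_prefix_root_pos:
  assumes "reduced_expression R w (u @ s # v)"
  shows "act (wp u) (rt s) \<in> pos_roots R"
proof -
  have sub: "set u \<subseteq> S" "s \<in> S" "set v \<subseteq> S" and l: "len (wp (u @ s # v)) = length u + 1 + length v"
    using assms by (auto simp: reduced_expression_iff)
  have "len (wp (u @ s # v)) \<le> len (wp u \<bullet> s) + len (wp v)"
    using sub len_mult_le [of "wp u \<bullet> s" "wp v"] by (simp add: word_append W.m_assoc)
  then have "len (wp u) < len (wp u \<bullet> s)"
    using l len_le [OF sub(1)] len_le [OF sub(3)] by simp
  then show ?thesis
    using sub act_root_positive by (simp add: pos_roots_eq roots_act roots_gen)
qed

text \<open>The inverse of \<open>w\<close> has a reduced word ending in \<open>s\<close>, and such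
  a last letter has its root sent to a negative one. This is the sign change that makes a flip
  possible.\<close>

lemma reduced_first_root_neg:
  assumes "reduced_expression R w (s # u)"
  shows "act (inv_W w) (rt s) \<notin> pos_roots R"
proof -
  have sub: "set u \<subseteq> S" "s \<in> S" and w: "w = s \<bullet> wp u" and l: "len (s \<bullet> wp u) = Suc (length u)"
    using assms by (auto simp: reduced_expression_iff)
  have "len (inv_W w) = len w" using w sub by (intro len_inv) auto
  moreover have iw: "inv_W w = inv_W (wp u) \<bullet> s" using sub w by (simp add: W.inv_mult_group)
  ultimately have "len (inv_W (wp u) \<bullet> s) = Suc (length u)" using l w by metis
  then have "len (inv_W (wp u)) < len (inv_W (wp u) \<bullet> s)"
    using sub len_le [OF sub(1)] by (simp add: len_inv)
  then have "act (inv_W (wp u)) (rt s) \<in> cone" using sub by (intro act_root_positive) auto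
  moreover have "act (inv_W w) (rt s) = - act (inv_W (wp u)) (rt s)"
    unfolding iw using sub by (simp add: act_mult act_gen_root act_minus)
  ultimately show ?thesis
    using pos_root_not_neg [of "act (inv_W w) (rt s)"] by auto
qed

end

section \<open>Flips\<close>

lemma nths_take: "nths (take k xs) A = nths xs (A \<inter> {..<k})"
proof (induction xs arbitrary: k A)
  case (Cons x xs)
  show ?case
  proof (cases k)
    case (Suc k')
    have "{j. Suc j \<in> A} \<inter> {..<k'} = {j. Suc j \<in> A \<and> j < k'}" by auto
    then show ?thesis by (simp add: Suc nths_Cons Cons)
  qed (simp add: nths_Cons)
qed simp

lemma length_nths_Compl_insert:
  assumes "j < length xs" "j \<notin> I"
  shows "length (nths xs (- I)) = Suc (length (nths xs (- insert j I)))"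
proof -
  have "{i. i < length xs \<and> i \<in> - I} = insert j {i. i < length xs \<and> i \<in> - insert j I}"
    using assms by auto
  then show ?thesis unfolding length_nths by simp
qed

lemma set_nths_subsetI: "set xs \<subseteq> A \<Longrightarrow> set (nths xs X) \<subseteq> A"
  using set_nths_subset [of xs X] by blast

context coxeter_roots
begin

abbreviation "rf \<equiv> root_function R"

lemma nths_word_closed [simp]: "set Q \<subseteq> S \<Longrightarrow> wp (nths Q X) \<in> carrier W"
  by (intro word_closed set_nths_subsetI)

lemma root_function_take:
  "rf Q I k = act (wp (nths (take k Q) (- I))) (rt (Q ! k))"
  unfolding root_function_def subword_prod_def nths_take Diff_eq
  by (subst Int_commute) (rule HOL.refl)

lemma root_function_root: "set Q \<subseteq> S \<Longrightarrow> j < length Q \<Longrightarrow> rf Q I j \<in> roots R"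
  unfolding root_function_def subword_prod_def
  by (intro roots_act roots_gen nths_word_closed) auto

lemma root_function_0 [simp]: "rf (q # Q) I 0 = rt q"
  by (simp add: root_function_take)

text \<open>With complements in place of bounded differences, dropping the first letter turns the
  set of omitted positions into its preimage under \<open>Suc\<close>.\<close>

lemma nths_Cons_Compl:
  "nths (q # Q) (- I) = (if 0 \<in> I then [] else [q]) @ nths Q (- (Suc -` I))"
proof -
  have "{j. Suc j \<in> - I} = - (Suc -` I)" by auto
  then show ?thesis by (simp add: nths_Cons)
qed

lemma root_function_Suc:
  assumes "q \<in> S" "set Q \<subseteq> S"
  shows "rf (q # Q) I (Suc j) =
    (if 0 \<in> I then rf Q (Suc -` I) j else act q (rf Q (Suc -` I) j))"
proof -
  have "set (take j Q) \<subseteq> S" by (rule order_trans [OF set_take_subset assms(2)])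
  then show ?thesis
    unfolding root_function_take take_Suc_Cons nths_Cons_Compl
    using assms by (simp add: act_mult)
qed

text \<open>Apply the letters outside \<open>I\<close> to \<open>\<gamma>\<close> one after another.
  A generator turns only its own simple root negative, so the sign can change only when the current
  vector is the simple root of the letter read, and pulled back this says that the root function
  takes the value \<open>\<gamma>\<close> there.\<close>

lemma exists_sign_change:
  assumes "set Q \<subseteq> S" "\<gamma> \<in> pos_roots R" "act (inv_W (wp (nths Q (- I)))) \<gamma> \<notin> pos_roots R"
  shows "\<exists>j<length Q. j \<notin> I \<and> rf Q I j = \<gamma>"
  using assms
proof (induction Q arbitrary: I \<gamma>)
  case (Cons q Q)
  define I1 where "I1 = (Suc -` I)"
  have q: "q \<in> S" "set Q \<subseteq> S" using Cons.prems by auto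
  have *: "\<exists>j<length (q # Q). j \<notin> I \<and> rf (q # Q) I j = \<gamma>"
    if "j < length Q" "j \<notin> I1" "rf (q # Q) I (Suc j) = \<gamma>" for j
    using that by (intro exI [of _ "Suc j"]) (auto simp: I1_def)
  show ?case
  proof (cases "0 \<in> I")
    case True
    then have "act (inv_W (wp (nths Q (- I1)))) \<gamma> \<notin> pos_roots R"
      using Cons.prems by (simp add: nths_Cons_Compl I1_def)
    then obtain j where "j < length Q" "j \<notin> I1" "rf Q I1 j = \<gamma>"
      using Cons.IH [OF q(2) Cons.prems(2)] by blast
    then show ?thesis using True q * by (simp add: root_function_Suc I1_def)
  next
    case False
    show ?thesis
    proof (cases "\<gamma> = rt q")
      case True
      then show ?thesis using False by (intro exI [of _ 0]) auto
    next
      case neq: False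
      have "act (inv_W (wp (nths Q (- I1)))) (act q \<gamma>) \<notin> pos_roots R"
        using Cons.prems False q by (simp add: nths_Cons_Compl I1_def W.inv_mult_group act_mult)
      then obtain j where "j < length Q" "j \<notin> I1" "rf Q I1 j = act q \<gamma>"
        using Cons.IH [OF q(2) act_gen_pos_root [OF q(1) Cons.prems(2) neq]] by blast
      then show ?thesis using False q * by (simp add: root_function_Suc I1_def)
    qed
  qed
qed simp

text \<open>The exchange condition: the prefix before the omitted letter conjugates that letter to
  the reflection in its root.\<close>

lemma delete_letter:
  assumes "set Q \<subseteq> S" "j < length Q" "j \<notin> I"
  shows "wp (nths Q (- insert j I)) = reflect (rf Q I j) \<bullet> wp (nths Q (- I))"
  using assms
proof (induction Q arbitrary: I j)
  case (Cons q Q)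
  define I1 where "I1 = (Suc -` I)"
  have q: "q \<in> S" "set Q \<subseteq> S" using Cons.prems by auto
  show ?case
  proof (cases j)
    case 0
    then have "Suc -` insert j I = I1" by (auto simp: I1_def)
    then show ?thesis using 0 Cons.prems q by (simp add: nths_Cons_Compl I1_def [symmetric])
  next
    case (Suc i)
    then have i: "i < length Q" "i \<notin> I1" using Cons.prems by (auto simp: I1_def)
    have I1: "Suc -` insert j I = insert i I1" using Suc by (auto simp: I1_def)
    have root: "rf Q I1 i \<in> roots R" using q i by (intro root_function_root)
    have "wp (nths Q (- insert i I1)) = reflect (rf Q I1 i) \<bullet> wp (nths Q (- I1))"
      using Cons.IH [OF q(2) i] .
    moreover have "0 \<in> insert j I \<longleftrightarrow> 0 \<in> I" using Suc by simp
    ultimately show ?thesis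
      using q root unfolding nths_Cons_Compl I1 I1_def [symmetric] unfolding Suc root_function_Suc [OF q] I1_def [symmetric]
      by (auto simp: root_reflection_act W.m_assoc)
  qed
qed simp

lemma root_function_insert:
  assumes "set Q \<subseteq> S" "k < length Q" "j \<notin> I"
  shows "rf Q (insert j I) k =
    (if k \<le> j then rf Q I k else act (reflect (rf Q I j)) (rf Q I k))"
proof (cases "k \<le> j")
  case True
  then have "{..<k} - insert j I = {..<k} - I" by auto
  then show ?thesis using True by (simp add: root_function_def)
next
  case False
  have sub: "set (take k Q) \<subseteq> S" by (rule order_trans [OF set_take_subset assms(1)])
  have j: "j < length (take k Q)" using False assms by simp
  have eq: "rf (take k Q) I j = rf Q I j"
    using False by (simp add: root_function_take min_def)
  have "reflect (rf Q I j) \<in> carrier W"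
    using False assms by (intro refl_closed root_function_root) auto
  then show ?thesis
    unfolding root_function_take [of Q _ k] delete_letter [OF sub j assms(3)] eq
    using False sub by (simp add: act_mult)
qed

lemma act_refl_subspace_iff:
  assumes "\<gamma> \<in> roots R" "\<gamma> \<in> V" "subspace V"
  shows "act (reflect \<gamma>) v \<in> V \<longleftrightarrow> v \<in> V"
proof -
  have "act (reflect \<gamma>) v \<in> V" if "v \<in> V" for v
    unfolding act_refl [OF assms(1)] using assms that by (intro subspace_diff subspace_scale)
  from this [of v] this [of "act (reflect \<gamma>) v"] show ?thesis using assms by auto
qed

lemma reduced_expression_Cons:
  assumes "reduced_expression R w (q # u)"
  shows "reduced_expression R (q \<bullet> w) u"
proof -
  have sub: "q \<in> S" "set u \<subseteq> S" and w: "w = q \<bullet> wp u" and l: "len w = Suc (length u)"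
    using assms by (auto simp: reduced_expression_iff)
  have "len w \<le> len q + len (wp u)" using w len_mult_le sub by simp
  then have "length u = len (wp u)" using l len_gen [OF sub(1)] len_le [OF sub(2)] by simp
  then show ?thesis using sub w by (simp add: reduced_expression_iff)
qed

text \<open>Some letter \<open>j\<close> has root \<open>rt q\<close> because of the sign change.
  Omitting it multiplies the product by \<open>q\<close> on the left, so putting \<open>q\<close> in
  front restores both the product and the length.\<close>

lemma first_letter_flip:
  assumes Q: "q \<in> S" "set Q \<subseteq> S"
    and red: "reduced_expression R w (nths Q (- I))"
    and neg: "act (inv_W w) (rt q) \<notin> pos_roots R"
  obtains j where "j < length Q" "j \<notin> I" "rf Q I j = rt q" "rf Q (insert j I) j = rt q"
    "reduced_expression R w (q # nths Q (- insert j I))"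
    "\<And>V k. subspace V \<Longrightarrow> rt q \<in> V \<Longrightarrow> k < length Q \<Longrightarrow>
      rf Q (insert j I) k \<in> V \<longleftrightarrow> rf Q I k \<in> V"
proof -
  have w: "w = wp (nths Q (- I))" and l: "length (nths Q (- I)) = len w"
    using red by (auto simp: reduced_expression_iff)
  obtain j where j: "j < length Q" "j \<notin> I" "rf Q I j = rt q"
    using exists_sign_change [of Q "rt q" I] Q neg pos_roots_gen w by auto
  have "wp (nths Q (- insert j I)) = q \<bullet> w"
    using delete_letter [OF Q(2) j(1,2)] j(3) Q w by simp
  moreover have "Suc (length (nths Q (- insert j I))) = len w"
    using length_nths_Compl_insert [OF j(1,2)] l by simp
  moreover have "w \<in> carrier W" using Q w by simp
  ultimately have "reduced_expression R w (q # nths Q (- insert j I))"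
    using Q by (auto simp: reduced_expression_iff dest!: in_set_nthsD)
  moreover have "rf Q (insert j I) k \<in> V \<longleftrightarrow> rf Q I k \<in> V"
    if "subspace V" "rt q \<in> V" "k < length Q" for V k
    using act_refl_subspace_iff [of "rt q" V "rf Q I k"] that roots_gen Q j
    by (simp add: root_function_insert)
  ultimately show ?thesis
    using that [of j] j Q by (simp add: root_function_insert)
qed

text \<open>
  In the mixed cases, where the first letter lies in exactly one of the two complements, the facet that
  contains the first position is flipped there. A flip at a root in \<open>V\<close> does not change membership of
  the values of the root function in \<open>V\<close>.
\<close>

theorem flat_positions_transfer:
  assumes "set Q \<subseteq> S" "subspace V"
    and "reduced_expression R w (nths Q (- I))" "reduced_expression R w (nths Q (- I'))"
    and "\<And>j. j < length Q \<Longrightarrow> j \<in> I \<Longrightarrow> rf Q I j \<notin> V \<Longrightarrow> j \<in> I'"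
    and "j < length Q"
  shows "(rf Q I j \<in> V \<longleftrightarrow> rf Q I' j \<in> V) \<and> (rf Q I j \<notin> V \<longrightarrow> (j \<in> I \<longleftrightarrow> j \<in> I'))"
  using assms
proof (induction Q arbitrary: I I' V w j)
  case (Cons q Q)
  have q: "q \<in> S" "set Q \<subseteq> S" using Cons.prems by auto
  have V: "subspace V" using Cons.prems by simp
  have act_q: "act q v \<in> V \<longleftrightarrow> v \<in> V" if "rt q \<in> V" for v
    using act_refl_subspace_iff [OF roots_gen [OF q(1)] that V] q by simp
  define sh where "sh I = (Suc -` I)" for I
  have rfs: "rf (q # Q) I (Suc j) = (if 0 \<in> I then rf Q (sh I) j else act q (rf Q (sh I) j))" for I j
    using root_function_Suc [OF q] by (simp add: sh_def)
  have nths: "nths (q # Q) (- I) = (if 0 \<in> I then [] else [q]) @ nths Q (- sh I)" for I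
    using nths_Cons_Compl [of q Q] by (simp only: sh_def)
  have both_out: "(rf (q # Q) I j \<in> V \<longleftrightarrow> rf (q # Q) I' j \<in> V) \<and>
      (rf (q # Q) I j \<notin> V \<longrightarrow> (j \<in> I \<longleftrightarrow> j \<in> I'))"
    if out: "0 \<notin> I" "0 \<notin> I'"
      and red: "reduced_expression R w (nths (q # Q) (- I))" "reduced_expression R w (nths (q # Q) (- I'))"
      and H: "\<And>j. j < length (q # Q) \<Longrightarrow> j \<in> I \<Longrightarrow> rf (q # Q) I j \<notin> V \<Longrightarrow> j \<in> I'"
      and j: "j < length (q # Q)" for I I' j
  proof (cases j)
    case (Suc i)
    \<comment> \<open>When both words use the first letter, root functions of the tail differ from
      those of the full word by \<open>act q\<close>; hence the induction is for arbitrary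
      \<open>V\<close> and is applied to the preimage.\<close>
    have "subspace {v. act q v \<in> V}"
      using V q unfolding subspace_def by (simp add: act_add act_scaleR act_zero)
    moreover have "reduced_expression R (q \<bullet> w) (nths Q (- sh I))"
      "reduced_expression R (q \<bullet> w) (nths Q (- sh I'))"
      using red out reduced_expression_Cons by (auto simp: nths)
    moreover have "k \<in> sh I'" if "k < length Q" "k \<in> sh I" "rf Q (sh I) k \<notin> {v. act q v \<in> V}" for k
      using H [of "Suc k"] that out by (simp add: rfs) (simp add: sh_def)
    moreover have "i < length Q" using j Suc by simp
    ultimately have "(rf Q (sh I) i \<in> {v. act q v \<in> V} \<longleftrightarrow> rf Q (sh I') i \<in> {v. act q v \<in> V}) \<and>
        (rf Q (sh I) i \<notin> {v. act q v \<in> V} \<longrightarrow> (i \<in> sh I \<longleftrightarrow> i \<in> sh I'))"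
      by (rule Cons.IH [OF q(2)])
    then show ?thesis using out by (simp add: Suc rfs) (simp add: sh_def)
  qed (use out in auto)
  define flip where "flip I i = insert (Suc i) (I - {0})" for I :: "nat set" and i
  have flip: "sh (flip I i) = insert i (sh I)" "0 \<notin> flip I i" for I i
    by (auto simp: flip_def sh_def)
  note red = Cons.prems(3,4) and H = Cons.prems(5)
  consider "0 \<notin> I" "0 \<notin> I'" | "0 \<in> I" "0 \<in> I'" | "0 \<in> I" "0 \<notin> I'" | "0 \<notin> I" "0 \<in> I'" by blast
  then show ?case
  proof cases
    case 1
    then show ?thesis using both_out red H Cons.prems(6) by blast
  next
    case 2
    show ?thesis
    proof (cases j)
      case (Suc i)
      have "reduced_expression R w (nths Q (- sh I))" "reduced_expression R w (nths Q (- sh I'))"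
        using red 2 by (auto simp: nths)
      moreover have "k \<in> sh I'" if "k < length Q" "k \<in> sh I" "rf Q (sh I) k \<notin> V" for k
        using H [of "Suc k"] that 2 by (simp add: rfs) (simp add: sh_def)
      moreover have "i < length Q" using Cons.prems Suc by simp
      ultimately have "(rf Q (sh I) i \<in> V \<longleftrightarrow> rf Q (sh I') i \<in> V) \<and>
          (rf Q (sh I) i \<notin> V \<longrightarrow> (i \<in> sh I \<longleftrightarrow> i \<in> sh I'))"
        by (rule Cons.IH [OF q(2) V])
      then show ?thesis using 2 by (simp add: Suc rfs) (simp add: sh_def)
    qed (use 2 in auto)
  next
    case 3
    \<comment> \<open>Position 0 is in \<open>I\<close> but not in \<open>I'\<close>, which the
      hypothesis permits only when its root lies in \<open>V\<close>.\<close>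
    have rtq: "rt q \<in> V" using H [of 0] 3 by auto
    have "reduced_expression R w (nths Q (- sh I))" using red 3 by (simp add: nths)
    moreover have "act (inv_W w) (rt q) \<notin> pos_roots R"
      using red(2) 3 by (intro reduced_first_root_neg [of w q "nths Q (- sh I')"]) (simp add: nths)
    ultimately obtain i where i: "i < length Q" "i \<notin> sh I" "rf Q (sh I) i = rt q"
      "reduced_expression R w (q # nths Q (- insert i (sh I)))"
      "\<And>V k. subspace V \<Longrightarrow> rt q \<in> V \<Longrightarrow> k < length Q \<Longrightarrow>
        rf Q (insert i (sh I)) k \<in> V \<longleftrightarrow> rf Q (sh I) k \<in> V"
      using first_letter_flip [OF q] by metis
    have J: "rf (q # Q) (flip I i) k \<in> V \<longleftrightarrow> rf (q # Q) I k \<in> V" if "k < length (q # Q)" for k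
      using that i(5) [OF V rtq] 3 by (cases k) (auto simp: rfs flip act_q rtq)
    have i_in: "rf (q # Q) I (Suc i) \<in> V" using i 3 rtq by (simp add: rfs)
    have "(rf (q # Q) (flip I i) j \<in> V \<longleftrightarrow> rf (q # Q) I' j \<in> V) \<and>
      (rf (q # Q) (flip I i) j \<notin> V \<longrightarrow> (j \<in> flip I i \<longleftrightarrow> j \<in> I'))"
    proof (rule both_out [OF flip(2) 3(2) _ red(2)])
      show "reduced_expression R w (nths (q # Q) (- flip I i))" using i by (simp add: nths flip)
      show "k \<in> I'" if "k < length (q # Q)" "k \<in> flip I i" "rf (q # Q) (flip I i) k \<notin> V" for k
      proof -
        have "rf (q # Q) I k \<notin> V" using J that by simp
        moreover from this have "k \<in> I" using that(2) i_in by (auto simp: flip_def)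
        ultimately show ?thesis using H that(1) by simp
      qed
    qed (use Cons.prems in simp)
    moreover have "j \<in> flip I i \<longleftrightarrow> j \<in> I" if "rf (q # Q) I j \<notin> V"
    proof -
      have "j \<noteq> Suc i" using that i_in by auto
      moreover have "j \<noteq> 0" using that rtq by (cases j) auto
      ultimately show ?thesis by (auto simp: flip_def)
    qed
    ultimately show ?thesis using J [of j] Cons.prems(6) by simp
  next
    case 4
    have "reduced_expression R w (nths Q (- sh I'))" using red 4 by (simp add: nths)
    moreover have "act (inv_W w) (rt q) \<notin> pos_roots R"
      using red(1) 4 by (intro reduced_first_root_neg [of w q "nths Q (- sh I)"]) (simp add: nths)
    ultimately obtain i where i: "i < length Q" "i \<notin> sh I'" "rf Q (sh I') i = rt q"
      "rf Q (insert i (sh I')) i = rt q"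
      "reduced_expression R w (q # nths Q (- insert i (sh I')))"
      "\<And>V k. subspace V \<Longrightarrow> rt q \<in> V \<Longrightarrow> k < length Q \<Longrightarrow>
        rf Q (insert i (sh I')) k \<in> V \<longleftrightarrow> rf Q (sh I') k \<in> V"
      using first_letter_flip [OF q] by metis
    have C: "(rf (q # Q) I k \<in> V \<longleftrightarrow> rf (q # Q) (flip I' i) k \<in> V) \<and>
      (rf (q # Q) I k \<notin> V \<longrightarrow> (k \<in> I \<longleftrightarrow> k \<in> flip I' i))" if "k < length (q # Q)" for k
    proof (rule both_out [OF 4(1) flip(2) red(1) _ _ that])
      show "reduced_expression R w (nths (q # Q) (- flip I' i))" using i by (simp add: nths flip)
      show "k \<in> flip I' i" if "k < length (q # Q)" "k \<in> I" "rf (q # Q) I k \<notin> V" for k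
        using H [OF that] that(2) 4(1) by (cases k) (auto simp: flip_def)
    qed
    \<comment> \<open>The hypothesis constrains only positions of \<open>I\<close>, so
      \<open>rt q \<in> V\<close> has to be extracted indirectly. If the root at
      \<open>Suc i\<close> were outside \<open>V\<close>, the comparison \<open>C\<close> would put
      \<open>Suc i\<close> into \<open>I\<close>, and the hypothesis would then put it into
      \<open>I'\<close>. The flipped root there is \<open>- rt q\<close>.\<close>
    have "Suc i \<notin> I'" using i by (simp add: sh_def)
    then have i_in: "rf (q # Q) (flip I' i) (Suc i) \<in> V"
      using C [of "Suc i"] H [of "Suc i"] i(1) by (auto simp: flip_def)
    moreover have "rf (q # Q) (flip I' i) (Suc i) = - rt q"
      using i q by (simp add: rfs flip act_gen_root)
    ultimately have rtq: "rt q \<in> V" using subspace_neg [OF V] by force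
    have J: "rf (q # Q) (flip I' i) k \<in> V \<longleftrightarrow> rf (q # Q) I' k \<in> V" if "k < length (q # Q)" for k
      using that i(6) [OF V rtq] 4 by (cases k) (auto simp: rfs flip act_q rtq)
    have "j \<in> flip I' i \<longleftrightarrow> j \<in> I'" if "rf (q # Q) I j \<notin> V"
    proof -
      have "j \<noteq> Suc i" using that i_in C [of j] Cons.prems(6) by auto
      moreover have "j \<noteq> 0" using that rtq by (cases j) auto
      ultimately show ?thesis by (auto simp: flip_def)
    qed
    then show ?thesis using C [of j] J [of j] Cons.prems(6) by auto
  qed
qed simp

end

section \<open>Subword complexes and reduced words\<close>

lemma nths_conv_filter_upt: "nths xs A = map ((!) xs) (filter (\<lambda>i. i \<in> A) [0..<length xs])"
proof (induction xs rule: rev_induct)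
  case (snoc x xs)
  have "map ((!) (xs @ [x])) (filter (\<lambda>i. i \<in> A) [0..<length xs]) =
      map ((!) xs) (filter (\<lambda>i. i \<in> A) [0..<length xs])"
    by (rule map_cong) (auto simp: nth_append)
  then show ?case using snoc by (simp add: nths_append)
qed simp

lemma nths_eq_filter:
  assumes "\<And>i. i < length xs \<Longrightarrow> i \<in> A \<longleftrightarrow> P (xs ! i)"
  shows "nths xs A = filter P xs"
proof -
  have "filter P (map ((!) xs) [0..<length xs]) = map ((!) xs) (filter (\<lambda>i. i \<in> A) [0..<length xs])"
    unfolding filter_map by (rule arg_cong [of _ _ "map _"], rule filter_cong) (use assms in auto)
  then show ?thesis by (simp add: nths_conv_filter_upt map_nth)
qed

lemma nths_cong:
  assumes "\<And>i. i < length xs \<Longrightarrow> i \<in> A \<longleftrightarrow> i \<in> A'" shows "nths xs A = nths xs A'"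
  unfolding nths_conv_filter_upt
  by (rule arg_cong [of _ _ "map _"], rule filter_cong) (use assms in auto)

text \<open>The bridge between indices of a subword and positions of the full word: a prefix of the
  subword is selected by a bound on positions.\<close>

lemma take_filter_upt:
  assumes "k < length (filter P [0..<n])"
  shows "take k (filter P [0..<n]) = filter P [0..<filter P [0..<n] ! k]"
proof (rule sorted_distinct_set_unique)
  let ?xs = "filter P [0..<n]"
  have s: "sorted_wrt (<) ?xs" by (simp add: sorted_wrt_filter)
  have in_xs: "?xs ! i < n \<and> P (?xs ! i)" if "i < length ?xs" for i
    using nth_mem [OF that] by simp
  show "set (take k ?xs) = set (filter P [0..<?xs ! k])"
  proof (intro subset_antisym subsetI)
    fix j assume "j \<in> set (take k ?xs)"
    then obtain i where "i < k" "j = ?xs ! i" using assms by (auto simp: in_set_conv_nth)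
    then show "j \<in> set (filter P [0..<?xs ! k])"
      using sorted_wrt_nth_less [OF s, of i k] in_xs [of i] assms by simp
  next
    fix j assume j: "j \<in> set (filter P [0..<?xs ! k])"
    then have "j \<in> set ?xs" using in_xs [OF assms] by simp
    then obtain i where i: "i < length ?xs" "j = ?xs ! i" by (metis in_set_conv_nth)
    then have "i < k"
      using sorted_wrt_nth_less [OF s, of k i] j by (cases i k rule: linorder_cases) auto
    then show "j \<in> set (take k ?xs)" using i by (auto simp: in_set_conv_nth)
  qed
qed (simp_all add: sorted_wrt_take sorted_wrt_filter)

lemma subseq_nths_mono: "X \<subseteq> A \<Longrightarrow> subseq (nths xs X) (nths xs A)"
proof (induction xs arbitrary: X A)
  case (Cons x xs)
  have "subseq (nths xs {j. Suc j \<in> X}) (nths xs {j. Suc j \<in> A})"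
    using Cons.prems by (intro Cons.IH) auto
  then show ?case using Cons.prems by (auto simp: nths_Cons)
qed simp

lemma subword_complex_iff:
  "K \<in> subword_complex R Q \<pi> \<longleftrightarrow>
    K \<subseteq> {..<length Q} \<and> (\<exists>X \<subseteq> {..<length Q} - K. reduced_expression R \<pi> (nths Q X))"
proof -
  have "(\<exists>u. subseq u (nths Q A) \<and> reduced_expression R \<pi> u) \<longleftrightarrow>
      (\<exists>X \<subseteq> A. reduced_expression R \<pi> (nths Q X))" for A
  proof
    assume "\<exists>u. subseq u (nths Q A) \<and> reduced_expression R \<pi> u"
    then obtain N where N: "reduced_expression R \<pi> (nths (nths Q A) N)"
      unfolding subseq_conv_nths by blast
    \<comment> \<open>\<open>N\<close> selects letters of the subword; \<open>M\<close> is the same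
      selection by positions in \<open>Q\<close>, found through the rank of each position within
      \<open>A\<close>.\<close>
    define M where "M = {i \<in> A. \<exists>j \<in> N. card {i' \<in> A. i' < i} = j}"
    have "M \<subseteq> A" "nths (nths Q A) N = nths Q M" by (auto simp only: M_def nths_nths)
    then show "\<exists>X \<subseteq> A. reduced_expression R \<pi> (nths Q X)" using N by auto
  qed (use subseq_nths_mono in blast)
  then show ?thesis by (simp add: subword_complex_def)
qed

lemma reduced_expression_length_eq:
  "reduced_expression R w u \<Longrightarrow> reduced_expression R w v \<Longrightarrow> length u = length v"
  unfolding reduced_expression_def by (intro le_antisym) auto

text \<open>All reduced expressions of an element have the same length, so nested complements of
  reduced subwords coincide. This holds for any record of this type, hence for
  \<open>flat_group R F\<close> as well.\<close>

lemma facets_subword_complex_iff: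
  "K \<in> facets (subword_complex R Q \<pi>) \<longleftrightarrow>
    K \<subseteq> {..<length Q} \<and> reduced_expression R \<pi> (nths Q (- K))"
proof
  assume K: "K \<in> facets (subword_complex R Q \<pi>)"
  then obtain X where X: "K \<subseteq> {..<length Q}" "X \<subseteq> {..<length Q} - K"
    "reduced_expression R \<pi> (nths Q X)"
    by (auto simp: facets_def subword_complex_iff)
  have "{..<length Q} - X \<in> subword_complex R Q \<pi>"
    unfolding subword_complex_iff using X by (intro conjI exI [of _ X]) auto
  moreover have "K \<subseteq> {..<length Q} - X" using X by auto
  ultimately have "{..<length Q} - X = K" using K by (auto simp: facets_def)
  then have "nths Q (- K) = nths Q X" by (intro nths_cong) auto
  then show "K \<subseteq> {..<length Q} \<and> reduced_expression R \<pi> (nths Q (- K))" using X by simp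
next
  assume K: "K \<subseteq> {..<length Q} \<and> reduced_expression R \<pi> (nths Q (- K))"
  have eq: "nths Q (- K) = nths Q ({..<length Q} - K)" by (rule nths_cong) auto
  have "K \<in> subword_complex R Q \<pi>"
    unfolding subword_complex_iff using K eq by (intro conjI exI [of _ "{..<length Q} - K"]) auto
  moreover have "C = K" if C: "C \<in> subword_complex R Q \<pi>" "K \<subseteq> C" for C
  proof -
    obtain X where X: "C \<subseteq> {..<length Q}" "X \<subseteq> {..<length Q} - C"
      "reduced_expression R \<pi> (nths Q X)"
      using C by (auto simp: subword_complex_iff)
    have "length (nths Q X) = length (nths Q ({..<length Q} - K))"
      using reduced_expression_length_eq X(3) K eq by metis
    moreover have "{i. i < length Q \<and> i \<in> X} = X"
      "{i. i < length Q \<and> i \<in> {..<length Q} - K} = {..<length Q} - K" using X by auto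
    ultimately have "card X = card ({..<length Q} - K)" by (simp add: length_nths)
    then have "X = {..<length Q} - K" using X C by (intro card_subset_eq) auto
    then show ?thesis using X C by auto
  qed
  ultimately show "K \<in> facets (subword_complex R Q \<pi>)" by (auto simp: facets_def)
qed

section \<open>The reflection subgroup of a flat\<close>

context coxeter_roots
begin

context
  fixes F :: "'v list"
begin

abbreviation "\<Phi>F \<equiv> flat_pos_roots R F"
abbreviation "\<Delta>F \<equiv> flat_simple_roots R F"

lemma flat_pos_roots_iff: "\<delta> \<in> \<Phi>F \<longleftrightarrow> \<delta> \<in> pos_roots R \<and> \<delta> \<in> span (set F)"
  by (auto simp: flat_pos_roots_def)

lemma flat_simple_roots_pos: "\<beta> \<in> \<Delta>F \<Longrightarrow> \<beta> \<in> pos_roots R"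
  and flat_simple_roots_roots: "\<beta> \<in> \<Delta>F \<Longrightarrow> \<beta> \<in> roots R"
  and flat_simple_roots_span: "\<beta> \<in> \<Delta>F \<Longrightarrow> \<beta> \<in> span (set F)"
  by (auto simp: flat_simple_roots_def flat_pos_roots_iff pos_roots_roots)

text \<open>If the image of \<open>\<delta>\<close> were negative, a multiple of
  \<open>\<beta>\<close> would be the sum of two positive roots of the flat, both different from
  \<open>\<beta>\<close>. This is exactly what the definition of \<open>flat_simple_roots\<close>
  forbids, once the multiple is seen to be positive.\<close>

lemma flat_simple_reflection_permutes:
  assumes "\<beta> \<in> \<Delta>F" "\<delta> \<in> \<Phi>F" "\<delta> \<noteq> \<beta>"
  shows "act (reflect \<beta>) \<delta> \<in> \<Phi>F"
proof -
  have b: "\<beta> \<in> roots R" "\<beta> \<in> pos_roots R" "\<beta> \<in> span (set F)"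
    using assms(1) flat_simple_roots_pos flat_simple_roots_roots flat_simple_roots_span by auto
  have d: "\<delta> \<in> roots R" "\<delta> \<in> pos_roots R" "\<delta> \<in> span (set F)"
    using assms(2) by (auto simp: flat_pos_roots_iff pos_roots_roots)
  have root: "act (reflect \<beta>) \<delta> \<in> roots R" using b d by (simp add: roots_act)
  have sp: "act (reflect \<beta>) \<delta> \<in> span (set F)"
    using act_refl_subspace_iff [of \<beta> "span (set F)" \<delta>] b d by simp
  have "act (reflect \<beta>) \<delta> \<in> pos_roots R"
  proof (rule ccontr)
    define \<epsilon> where "\<epsilon> = - act (reflect \<beta>) \<delta>"
    assume "act (reflect \<beta>) \<delta> \<notin> pos_roots R"
    then have e: "\<epsilon> \<in> pos_roots R" using neg_root_iff [OF root] by (simp add: \<epsilon>_def)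
    have esp: "\<epsilon> \<in> span (set F)" using sp by (simp add: \<epsilon>_def span_neg)
    define c where "c = 2 * B \<delta> \<beta> / B \<beta> \<beta>"
    have c: "c *\<^sub>R \<beta> = \<delta> + \<epsilon>" by (simp add: \<epsilon>_def act_refl b c_def)
    have cones: "\<beta> \<in> cone" "\<delta> \<in> cone" "\<epsilon> \<in> cone" using b d e by (auto simp: pos_roots_eq)
    \<comment> \<open>A nonpositive \<open>c\<close> would place
      \<open>- (\<delta> + \<epsilon>)\<close>, and after adding \<open>\<epsilon>\<close> also
      \<open>- \<delta>\<close>, in the cone.\<close>
    have "c > 0"
    proof (rule ccontr)
      assume "\<not> c > 0"
      then have "(- c) *\<^sub>R \<beta> \<in> cone" using cones by (intro cone_scaleR) auto
      then have "- (\<delta> + \<epsilon>) \<in> cone" by (simp flip: c)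
      then have "- (\<delta> + \<epsilon>) + \<epsilon> \<in> cone" using cones by (intro cone_add)
      then show False using pos_root_not_neg [OF d(2)] by simp
    qed
    have "\<epsilon> \<noteq> \<beta>"
    proof
      assume "\<epsilon> = \<beta>"
      then have "\<delta> = (c - 1) *\<^sub>R \<beta>" using c by (simp add: scaleR_diff_left)
      then show False using pos_roots_proportional d(2) b(2) assms(3) by blast
    qed
    then have "\<epsilon> \<in> convex_cone hull (\<Phi>F - {\<beta>})" "\<delta> \<in> convex_cone hull (\<Phi>F - {\<beta>})"
      using e esp assms by (auto intro!: hull_inc simp: flat_pos_roots_iff)
    then have "(1 / c) *\<^sub>R (\<delta> + \<epsilon>) \<in> convex_cone hull (\<Phi>F - {\<beta>})"
      using \<open>c > 0\<close> by (intro convex_cone_hull_mul convex_cone_hull_add) auto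
    then have "\<beta> \<in> convex_cone hull (\<Phi>F - {\<beta>})" using \<open>c > 0\<close> by (simp flip: c)
    then show False using assms(1) by (simp add: flat_simple_roots_def)
  qed
  then show ?thesis using sp by (simp add: flat_pos_roots_iff)
qed

section \<open>Inversions inside the subsystem of a flat\<close>

lemma reflections_closed:
  "set \<beta>s \<subseteq> roots R \<Longrightarrow> wp (map reflect \<beta>s) \<in> carrier W"
  by (intro W.word_prod_closed) auto

lemma reflections_snoc:
  assumes "set \<beta>s \<subseteq> roots R" "\<beta> \<in> roots R"
  shows "wp (map reflect (\<beta>s @ [\<beta>])) = wp (map reflect \<beta>s) \<bullet> reflect \<beta>"
proof -
  have "set (map reflect \<beta>s) \<subseteq> carrier W" "set [reflect \<beta>] \<subseteq> carrier W" using assms by auto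
  then show ?thesis using assms by (simp add: W.word_prod_append)
qed

lemma reflections_subspace_iff:
  assumes "set \<beta>s \<subseteq> roots R" "set \<beta>s \<subseteq> V" "subspace V"
  shows "act (wp (map reflect \<beta>s)) v \<in> V \<longleftrightarrow> v \<in> V"
  using assms
proof (induction \<beta>s arbitrary: v)
  case (Cons \<beta> \<beta>s)
  then show ?case by (simp add: act_mult reflections_closed act_refl_subspace_iff)
qed simp

text \<open>The inverse is used so that multiplying on the right by a simple reflection of the flat
  adds at most one root.\<close>

definition flat_inversions :: "'w \<Rightarrow> 'v set" where
  "flat_inversions w = {\<delta> \<in> \<Phi>F. act (inv_W w) \<delta> \<notin> pos_roots R}"

text \<open>Since \<open>reflect \<beta>\<close> permutes the positive roots of the flat other than
  \<open>\<beta>\<close>, only the sign at \<open>act p \<beta>\<close> can change. Invariance of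
  the span under \<open>p\<close> keeps pulled-back roots in the subsystem.\<close>

lemma flat_inversions_snoc:
  assumes p: "p \<in> carrier W" "\<And>v. act p v \<in> span (set F) \<longleftrightarrow> v \<in> span (set F)" and "\<beta> \<in> \<Delta>F"
  shows "flat_inversions (p \<bullet> reflect \<beta>) \<subseteq> insert (act p \<beta>) (flat_inversions p)"
    and "act p \<beta> \<in> pos_roots R \<Longrightarrow> act p \<beta> \<notin> flat_inversions p \<and>
      flat_inversions (p \<bullet> reflect \<beta>) = insert (act p \<beta>) (flat_inversions p)"
proof -
  have b: "\<beta> \<in> roots R" "\<beta> \<in> pos_roots R" "\<beta> \<in> span (set F)"
    using assms(3) flat_simple_roots_pos flat_simple_roots_roots flat_simple_roots_span by auto
  have inv: "act (inv_W (p \<bullet> reflect \<beta>)) v = act (reflect \<beta>) (act (inv_W p) v)" for v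
    using p(1) b by (simp add: W.inv_mult_group act_mult refl_inv)
  have sp: "act (inv_W p) v \<in> span (set F) \<longleftrightarrow> v \<in> span (set F)" for v
    using p(2) [of "act (inv_W p) v"] p(1) by simp
  show sub: "flat_inversions (p \<bullet> reflect \<beta>) \<subseteq> insert (act p \<beta>) (flat_inversions p)"
  proof
    fix \<delta> assume d: "\<delta> \<in> flat_inversions (p \<bullet> reflect \<beta>)"
    show "\<delta> \<in> insert (act p \<beta>) (flat_inversions p)"
    proof (cases "act (inv_W p) \<delta> \<in> pos_roots R")
      case True
      then have "act (inv_W p) \<delta> = \<beta>"
        using flat_simple_reflection_permutes [OF assms(3), of "act (inv_W p) \<delta>"] d
        by (auto simp: flat_inversions_def inv flat_pos_roots_iff sp)
      then show ?thesis using p(1) by auto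
    next
      case False
      then show ?thesis using d by (simp add: flat_inversions_def)
    qed
  qed
  assume pos: "act p \<beta> \<in> pos_roots R"
  have "- \<beta> \<notin> pos_roots R" using pos_root_not_neg [OF b(2)] by (simp add: pos_roots_eq)
  then have "act p \<beta> \<in> flat_inversions (p \<bullet> reflect \<beta>)"
    using pos p b by (simp add: flat_inversions_def flat_pos_roots_iff inv act_refl_root)
  moreover have "flat_inversions p \<subseteq> flat_inversions (p \<bullet> reflect \<beta>)"
  proof
    fix \<delta> assume "\<delta> \<in> flat_inversions p"
    then have d: "\<delta> \<in> \<Phi>F" "act (inv_W p) \<delta> \<notin> pos_roots R" by (auto simp: flat_inversions_def)
    define \<epsilon> where "\<epsilon> = - act (inv_W p) \<delta>"
    have root: "act (inv_W p) \<delta> \<in> roots R"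
      using d p by (simp add: flat_pos_roots_iff pos_roots_roots roots_act)
    have "\<epsilon> \<in> \<Phi>F"
      using d neg_root_iff [OF root] by (simp add: \<epsilon>_def flat_pos_roots_iff sp span_neg)
    moreover have "\<epsilon> \<noteq> \<beta>"
    proof
      assume "\<epsilon> = \<beta>"
      then have "act p \<beta> = - \<delta>" using p(1) by (auto simp: \<epsilon>_def act_minus)
      then show False using pos d pos_root_not_neg by (auto simp: flat_pos_roots_iff pos_roots_eq)
    qed
    ultimately have "act (reflect \<beta>) \<epsilon> \<in> pos_roots R"
      using flat_simple_reflection_permutes [OF assms(3)] by (auto simp: flat_pos_roots_iff)
    then have "- act (reflect \<beta>) (act (inv_W p) \<delta>) \<in> pos_roots R"
      using b by (simp add: \<epsilon>_def act_minus)
    then have "act (reflect \<beta>) (act (inv_W p) \<delta>) \<notin> pos_roots R"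
      using pos_root_not_neg by (auto simp: pos_roots_eq)
    then show "\<delta> \<in> flat_inversions (p \<bullet> reflect \<beta>)"
      using d by (simp add: flat_inversions_def inv)
  qed
  ultimately show "act p \<beta> \<notin> flat_inversions p \<and>
      flat_inversions (p \<bullet> reflect \<beta>) = insert (act p \<beta>) (flat_inversions p)"
    using sub b p(1) by (auto simp: flat_inversions_def)
qed

lemma flat_inversions_one: "flat_inversions \<one>\<^bsub>W\<^esub> = {}"
  by (auto simp: flat_inversions_def flat_pos_roots_iff)

lemma card_flat_inversions_le:
  "set \<beta>s \<subseteq> \<Delta>F \<Longrightarrow> finite (flat_inversions (wp (map reflect \<beta>s))) \<and>
    card (flat_inversions (wp (map reflect \<beta>s))) \<le> length \<beta>s"
proof (induction \<beta>s rule: rev_induct)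
  case (snoc \<beta> \<beta>s)
  define p where "p = wp (map reflect \<beta>s)"
  have sub: "set \<beta>s \<subseteq> roots R" "set \<beta>s \<subseteq> span (set F)" "\<beta> \<in> roots R" "\<beta> \<in> \<Delta>F"
    using snoc.prems flat_simple_roots_roots flat_simple_roots_span by auto
  have "flat_inversions (p \<bullet> reflect \<beta>) \<subseteq> insert (act p \<beta>) (flat_inversions p)"
    unfolding p_def using sub
    by (intro flat_inversions_snoc reflections_closed reflections_subspace_iff) auto
  moreover have fin: "finite (flat_inversions p)" "card (flat_inversions p) \<le> length \<beta>s"
    using snoc by (auto simp: p_def)
  ultimately have "finite (flat_inversions (p \<bullet> reflect \<beta>))"
    "card (flat_inversions (p \<bullet> reflect \<beta>)) \<le> card (insert (act p \<beta>) (flat_inversions p))"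
    by (auto intro: finite_subset card_mono)
  then show ?case
    using fin reflections_snoc [OF sub(1,3)] card_insert_le_m1 [of "Suc (length \<beta>s)" "flat_inversions p" "act p \<beta>"]
    by (simp add: p_def [symmetric] del: map_append)
qed (simp add: flat_inversions_one)

lemma card_flat_inversions_eq:
  assumes "set \<beta>s \<subseteq> \<Delta>F"
    and "\<And>k. k < length \<beta>s \<Longrightarrow> act (wp (map reflect (take k \<beta>s))) (\<beta>s ! k) \<in> pos_roots R"
  shows "card (flat_inversions (wp (map reflect \<beta>s))) = length \<beta>s"
  using assms
proof (induction \<beta>s rule: rev_induct)
  case (snoc \<beta> \<beta>s)
  define p where "p = wp (map reflect \<beta>s)"
  have sub: "set \<beta>s \<subseteq> \<Delta>F" "set \<beta>s \<subseteq> roots R" "set \<beta>s \<subseteq> span (set F)" "\<beta> \<in> roots R" "\<beta> \<in> \<Delta>F"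
    using snoc.prems(1) flat_simple_roots_roots flat_simple_roots_span by auto
  have "act p \<beta> \<in> pos_roots R" using snoc.prems(2) [of "length \<beta>s"] by (simp add: p_def)
  then have "act p \<beta> \<notin> flat_inversions p \<and>
      flat_inversions (p \<bullet> reflect \<beta>) = insert (act p \<beta>) (flat_inversions p)"
    unfolding p_def using sub
    by (intro flat_inversions_snoc reflections_closed reflections_subspace_iff) auto
  moreover have "card (flat_inversions p) = length \<beta>s"
    unfolding p_def
  proof (rule snoc.IH [OF sub(1)])
    fix k assume "k < length \<beta>s"
    then show "act (wp (map reflect (take k \<beta>s))) (\<beta>s ! k) \<in> pos_roots R"
      using snoc.prems(2) [of k] by (simp add: nth_append)
  qed
  moreover have "finite (flat_inversions p)" using card_flat_inversions_le sub by (simp add: p_def)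
  ultimately show ?case
    using reflections_snoc [OF sub(2,4)] by (simp add: p_def [symmetric] del: map_append)
qed (simp add: flat_inversions_one)

lemma flat_group_simps [simp]:
  "cgens (flat_group R F) = reflect ` \<Delta>F" "caction (flat_group R F) = act"
  "word_prod (cgroup (flat_group R F)) u = wp u"
  "carrier (cgroup (flat_group R F)) = generate W (reflect ` \<Delta>F)"
  by (simp_all add: flat_group_def)

lemma croot_flat_group: "\<beta> \<in> \<Delta>F \<Longrightarrow> croot (flat_group R F) (reflect \<beta>) = \<beta>"
  unfolding flat_group_def using refl_inj flat_simple_roots_pos
  by (auto intro!: the_equality)

text \<open>With positive prefix roots every letter adds an inversion, so the element has exactly
  \<open>length \<beta>s\<close> of them; any competing word has at least as many letters as
  inversions.\<close>

lemma reduced_expression_flat_group: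
  assumes "set \<beta>s \<subseteq> \<Delta>F"
    and "\<And>k. k < length \<beta>s \<Longrightarrow> act (wp (map reflect (take k \<beta>s))) (\<beta>s ! k) \<in> pos_roots R"
  shows "reduced_expression (flat_group R F) (wp (map reflect \<beta>s)) (map reflect \<beta>s)"
  unfolding reduced_expression_def flat_group_simps
proof (intro conjI allI impI)
  fix v assume v: "set v \<subseteq> reflect ` \<Delta>F \<and> wp v = wp (map reflect \<beta>s)"
  then have "v \<in> map reflect ` lists \<Delta>F"
    unfolding lists_image [symmetric] by (simp add: in_lists_conv_set subset_iff)
  then obtain \<gamma>s where g: "v = map reflect \<gamma>s" "set \<gamma>s \<subseteq> \<Delta>F"
    by (auto simp: in_lists_conv_set)
  then show "length (map reflect \<beta>s) \<le> length v"
    using card_flat_inversions_eq [OF assms] card_flat_inversions_le [OF g(2)] v by simp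
qed (use assms in auto)

end

end

section \<open>The subword complex of a flat\<close>

lemma length_filter_split:
  "length (filter P xs) = length (filter (\<lambda>x. P x \<and> A x) xs) + length (filter (\<lambda>x. P x \<and> \<not> A x) xs)"
  by (induction xs) auto

locale subword_flat = coxeter_roots R m B
  for R :: "('w, 'v::real_vector) reflection_group" and m B +
  fixes Q :: "'w list" and I :: "nat set" and F :: "'v list"
  assumes Q: "set Q \<subseteq> S" and flat: "is_flat F (root_list R Q I)"
begin

abbreviation "J \<equiv> flat_positions R Q I F"
abbreviation "V \<equiv> span (set F)"
abbreviation "r \<equiv> length Q"

definition pre :: "nat \<Rightarrow> 'w" where
  "pre n = wp (map ((!) Q) (filter (\<lambda>j. j \<notin> I \<and> j \<notin> J) [0..<n]))"

text \<open>Indexed by positions of \<open>Q\<close> and defined off the flat too: that these values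
  avoid the span of \<open>F\<close> is what keeps \<open>pre\<close> positive on the
  subsystem.\<close>

definition beta :: "nat \<Rightarrow> 'v" where
  "beta j = act (pre j) (rt (Q ! j))"

lemma letter: "j < r \<Longrightarrow> Q ! j \<in> S"
  using Q by auto

lemma letters: "n \<le> r \<Longrightarrow> set (map ((!) Q) (filter P [0..<n])) \<subseteq> S"
  using letter by auto

lemma pre_closed [simp]: "n \<le> r \<Longrightarrow> pre n \<in> carrier W"
  unfolding pre_def by (intro word_closed letters)

lemma pre_Suc:
  "Suc n \<le> r \<Longrightarrow> pre (Suc n) = (if n \<notin> I \<and> n \<notin> J then pre n \<bullet> Q ! n else pre n)"
  using letters [of n "\<lambda>j. j \<notin> I \<and> j \<notin> J"] letter [of n] by (simp add: pre_def word_append)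

lemma beta_root: "j < r \<Longrightarrow> beta j \<in> roots R"
  unfolding beta_def using letter by (intro roots_act roots_gen) auto

text \<open>The subspace that cuts out the flat may be replaced by the span of \<open>F\<close>: the
  span is contained in it and contains all entries of \<open>F\<close>.\<close>

lemma flat_positions_iff: "j \<in> J \<longleftrightarrow> j < r \<and> rf Q I j \<in> V"
  and flat_eq: "F = map (rf Q I) (filter (\<lambda>j. j \<in> J) [0..<r])"
proof -
  obtain U where U: "subspace U" "F = filter (\<lambda>v. v \<in> U) (map (rf Q I) [0..<r])"
    using flat by (auto simp: is_flat_def root_list_def)
  have "V \<subseteq> U" using U by (intro span_minimal) auto
  then have in_F: "rf Q I j \<in> set F \<longleftrightarrow> rf Q I j \<in> U" "rf Q I j \<in> set F \<longleftrightarrow> rf Q I j \<in> V"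
    if "j < r" for j
    using that U(2) by (auto intro: span_base)
  then show "j \<in> J \<longleftrightarrow> j < r \<and> rf Q I j \<in> V" by (auto simp: flat_positions_def)
  have "filter (\<lambda>j. rf Q I j \<in> U) [0..<r] = filter (\<lambda>j. j \<in> J) [0..<r]"
    using in_F by (intro filter_cong) (auto simp: flat_positions_def)
  then show "F = map (rf Q I) (filter (\<lambda>j. j \<in> J) [0..<r])"
    using U(2) by (simp add: filter_map comp_def)
qed

section \<open>Factoring products along the flat\<close>

definition flat_betas :: "nat set \<Rightarrow> nat \<Rightarrow> 'v list" where
  "flat_betas X n = map beta (filter (\<lambda>j. j \<in> X \<and> j \<in> J) [0..<n])"

lemma flat_betas_roots: "n \<le> r \<Longrightarrow> set (flat_betas X n) \<subseteq> roots R"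
  using beta_root by (auto simp: flat_betas_def)

text \<open>Moving a letter at a position of the flat to the left past the letters outside the flat turns it
  into a reflection \<open>s\<^sub>\<beta>\<close>.\<close>

lemma word_factorization:
  assumes "n \<le> r" "\<And>j. j < n \<Longrightarrow> j \<notin> J \<Longrightarrow> j \<in> X \<longleftrightarrow> j \<notin> I"
  shows "wp (map ((!) Q) (filter (\<lambda>j. j \<in> X) [0..<n])) = wp (map reflect (flat_betas X n)) \<bullet> pre n"
  using assms
proof (induction n)
  case 0
  then show ?case by (simp add: flat_betas_def pre_def)
next
  case (Suc n)
  define u where "u = map ((!) Q) (filter (\<lambda>j. j \<in> X) [0..<n])"
  define p where "p = wp (map reflect (flat_betas X n))"
  have q: "Q ! n \<in> S" using letter Suc.prems by simp
  have u: "set u \<subseteq> S" unfolding u_def using Suc.prems by (intro letters) simp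
  have IH: "wp u = p \<bullet> pre n" using Suc by (simp add: u_def p_def)
  have p: "p \<in> carrier W"
    unfolding p_def using Suc.prems by (intro reflections_closed flat_betas_roots) simp
  have xc: "pre n \<in> carrier W" using Suc.prems by simp
  have word: "wp (map ((!) Q) (filter (\<lambda>j. j \<in> X) [0..<Suc n])) = (if n \<in> X then wp u \<bullet> Q ! n else wp u)"
    using u q by (simp add: u_def word_append)
  show ?case
  proof (cases "n \<in> J")
    case True
    have "reflect (beta n) = pre n \<bullet> Q ! n \<bullet> inv_W (pre n)"
      unfolding beta_def using xc q by (intro root_reflection_act_gen)
    then have "reflect (beta n) \<bullet> pre n = pre n \<bullet> Q ! n"
      using xc q by (simp add: W.m_assoc)
    moreover have "wp (map reflect (flat_betas X (Suc n))) = (if n \<in> X then p \<bullet> reflect (beta n) else p)"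
      using reflections_snoc [of "flat_betas X n" "beta n"] flat_betas_roots [of n X] beta_root [of n]
        Suc.prems True by (simp add: flat_betas_def p_def)
    moreover have "reflect (beta n) \<in> carrier W" using beta_root Suc.prems by simp
    ultimately show ?thesis
      unfolding word using IH p xc q True Suc.prems(1) by (auto simp: pre_Suc W.m_assoc)
  next
    case False
    then have "n \<in> X \<longleftrightarrow> n \<notin> I" using Suc.prems(2) by simp
    moreover have "flat_betas X (Suc n) = flat_betas X n" using False by (simp add: flat_betas_def)
    ultimately show ?thesis
      unfolding word using IH p xc q False Suc.prems(1) by (auto simp: pre_Suc W.m_assoc p_def)
  qed
qed

lemma root_function_factorization:
  assumes "j < r"
  shows "rf Q I j = act (wp (map reflect (flat_betas (- I) j))) (beta j)"
proof -
  have "nths (take j Q) (- I) = map ((!) Q) (filter (\<lambda>i. i \<in> - I) [0..<j])"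
    unfolding nths_conv_filter_upt using assms by (auto simp: min_def)
  then have "wp (nths (take j Q) (- I)) = wp (map reflect (flat_betas (- I) j)) \<bullet> pre j"
    using word_factorization [of j "- I"] assms by simp
  moreover have "wp (map reflect (flat_betas (- I) j)) \<in> carrier W"
    using assms by (intro reflections_closed flat_betas_roots) simp
  ultimately show ?thesis
    using assms by (simp add: root_function_take beta_def act_mult)
qed

text \<open>The root at \<open>j\<close> is obtained from \<open>beta j\<close> by reflections in
  earlier values of \<open>beta\<close> that lie in \<open>V\<close> by induction, and these do not
  affect membership in \<open>V\<close>.\<close>

lemma beta_span_iff: "j < r \<Longrightarrow> beta j \<in> V \<longleftrightarrow> j \<in> J"
proof (induction j rule: less_induct)
  case (less j)
  have "set (flat_betas (- I) j) \<subseteq> V"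
    using less by (auto simp: flat_betas_def)
  then have "act (wp (map reflect (flat_betas (- I) j))) v \<in> V \<longleftrightarrow> v \<in> V" for v
    using less.prems by (intro reflections_subspace_iff flat_betas_roots) auto
  then show ?case
    using less.prems by (simp add: flat_positions_iff root_function_factorization)
qed

text \<open>Only a letter whose root \<open>beta n\<close> lies in \<open>V\<close> could turn a positive root of \<open>\<Phi>\<^sub>F\<close>
  negative, and those letters do not occur in \<open>pre\<close>.\<close>

lemma pre_positive:
  "n \<le> r \<Longrightarrow> \<delta> \<in> flat_pos_roots R F \<Longrightarrow> act (inv_W (pre n)) \<delta> \<in> pos_roots R"
proof (induction n)
  case 0
  then show ?case by (simp add: pre_def flat_pos_roots_iff)
next
  case (Suc n)
  then have IH: "act (inv_W (pre n)) \<delta> \<in> pos_roots R" and xc: "pre n \<in> carrier W"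
    and q: "Q ! n \<in> S" using letter by auto
  show ?case
  proof (cases "n \<notin> I \<and> n \<notin> J")
    case True
    have "act (inv_W (pre n)) \<delta> \<noteq> rt (Q ! n)"
    proof
      assume "act (inv_W (pre n)) \<delta> = rt (Q ! n)"
      then have "beta n = \<delta>" unfolding beta_def using xc by (metis act_act_inv)
      then show False
        using True Suc.prems beta_span_iff [of n] by (simp add: flat_pos_roots_iff)
    qed
    then have "act (Q ! n) (act (inv_W (pre n)) \<delta>) \<in> pos_roots R"
      using act_gen_pos_root [OF q IH] by simp
    moreover have "inv_W (pre (Suc n)) = Q ! n \<bullet> inv_W (pre n)"
      using True Suc.prems xc q by (simp add: pre_Suc W.inv_mult_group)
    ultimately show ?thesis using xc q by (simp add: act_mult)
  next
    case False
    then show ?thesis using IH Suc.prems by (auto simp: pre_Suc)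
  qed
qed

lemma beta_simple:
  assumes "j \<in> J" shows "beta j \<in> flat_simple_roots R F"
proof -
  have j: "j < r" using assms by (simp add: flat_positions_iff)
  have xc: "pre j \<in> carrier W" using j by simp
  have inv: "act (inv_W (pre j)) (beta j) = rt (Q ! j)" using xc by (simp add: beta_def)
  have span: "beta j \<in> V" using beta_span_iff j assms by simp
  have pos: "beta j \<in> flat_pos_roots R F"
  proof (rule ccontr)
    \<comment> \<open>Then \<open>- beta j\<close> is a positive root of the flat, and
      \<open>inv_W (pre j)\<close> would make \<open>- rt (Q ! j)\<close> positive.\<close>
    assume "beta j \<notin> flat_pos_roots R F"
    then have "- beta j \<in> flat_pos_roots R F"
      using root_pos_or_neg [OF beta_root [OF j]] span by (auto simp: flat_pos_roots_iff span_neg)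
    then have "act (inv_W (pre j)) (- beta j) \<in> pos_roots R" using pre_positive j by simp
    then have "- rt (Q ! j) \<in> pos_roots R" using xc inv by (simp add: act_minus)
    then show False
      using pos_root_not_neg [OF pos_roots_gen [OF letter [OF j]]] by (simp add: pos_roots_eq)
  qed
  moreover have "beta j \<notin> convex_cone hull (flat_pos_roots R F - {beta j})"
  proof
    let ?K = "convex_cone hull (pos_roots R - {rt (Q ! j)})"
    assume "beta j \<in> convex_cone hull (flat_pos_roots R F - {beta j})"
    also have "\<dots> \<subseteq> {v. act (inv_W (pre j)) v \<in> ?K}"
    proof (intro hull_minimal convex_cone_vimage_act convex_cone_convex_cone_hull subsetI CollectI hull_inc)
      fix \<delta> assume d: "\<delta> \<in> flat_pos_roots R F - {beta j}"
      then have "act (inv_W (pre j)) \<delta> \<noteq> act (inv_W (pre j)) (beta j)" using xc by simp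
      then show "act (inv_W (pre j)) \<delta> \<in> pos_roots R - {rt (Q ! j)}"
        using pre_positive [of j \<delta>] j d inv by simp
    qed (use xc in simp)
    finally show False using gen_not_in_cone_of_others [OF letter [OF j]] inv by simp
  qed
  ultimately show ?thesis by (simp add: flat_simple_roots_def)
qed

lemma flat_betas_simple: "set (flat_betas X n) \<subseteq> flat_simple_roots R F"
  using beta_simple by (auto simp: flat_betas_def)

section \<open>The word of the flat and its root function\<close>

definition js :: "nat list" where
  "js = filter (\<lambda>j. j \<in> J) [0..<r]"

lemma flat_positions_subset: "J \<subseteq> {..<r}"
  by (auto simp: flat_positions_def)

lemma set_js: "set js = J"
  using flat_positions_subset by (auto simp: js_def)

lemma distinct_js: "distinct js"
  by (simp add: js_def)

lemma sorted_list_of_flat_positions: "sorted_list_of_set J = js"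
  using set_js finite_subset [OF flat_positions_subset]
  by (intro sorted_distinct_set_unique) (auto simp: js_def sorted_wrt_filter)

lemma length_js: "length js = card J"
  using distinct_card [OF distinct_js] set_js by simp

lemma flat_pos_js: "flat_pos R Q I F = (!) js"
  by (auto simp: flat_pos_def sorted_list_of_flat_positions)

lemma js_nth: "k < length js \<Longrightarrow> js ! k \<in> J \<and> js ! k < r"
  using set_js flat_positions_subset nth_mem by blast

lemma flat_beta_eq:
  assumes "k < length js" shows "flat_beta R Q I F k = beta (js ! k)"
proof -
  let ?j = "js ! k"
  have "nths Q (({..<?j} - I) - J) = nths (take ?j Q) (- (I \<union> J))"
    unfolding nths_take by (rule arg_cong [of _ _ "nths Q"]) auto
  also have "\<dots> = map ((!) Q) (filter (\<lambda>i. i \<notin> I \<and> i \<notin> J) [0..<?j])"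
    unfolding nths_conv_filter_upt using js_nth [OF assms] by (auto simp: min_def)
  finally show ?thesis
    by (simp add: flat_beta_def Let_def flat_pos_js beta_def pre_def subword_prod_def)
qed

lemma flat_word_eq: "flat_word R Q I F = map reflect (map beta js)"
proof -
  have "flat_word R Q I F = map (\<lambda>k. reflect (beta (js ! k))) [0..<length js]"
    unfolding flat_word_def length_js [symmetric] using flat_beta_eq by simp
  also have "\<dots> = map (reflect \<circ> beta) (map ((!) js) [0..<length js])" by simp
  finally show ?thesis by (simp add: map_nth)
qed

lemma length_flat_word [simp]: "length (flat_word R Q I F) = length js"
  by (simp add: flat_word_eq)

lemma flat_facet_eq: "flat_facet R Q I F = {k. k < length js \<and> js ! k \<in> I}"
  by (simp add: flat_facet_def flat_pos_js length_js)

lemma nths_flat_word: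
  assumes "\<And>k. k < length js \<Longrightarrow> k \<in> Y \<longleftrightarrow> js ! k \<in> X"
  shows "nths (flat_word R Q I F) Y = map reflect (flat_betas X r)"
proof -
  have "nths js Y = filter (\<lambda>j. j \<in> X) js" using assms by (intro nths_eq_filter)
  then show ?thesis by (simp add: flat_word_eq flat_betas_def nths_map js_def conj_commute)
qed

lemma nths_flat_word_take:
  assumes "k < length js"
  shows "nths (take k (flat_word R Q I F)) (- flat_facet R Q I F) =
    map reflect (flat_betas (- I) (js ! k))"
proof -
  have "nths (take k js) (- flat_facet R Q I F) = filter (\<lambda>j. j \<in> - I) (take k js)"
    using assms by (intro nths_eq_filter) (auto simp: flat_facet_eq)
  also have "\<dots> = filter (\<lambda>j. j \<in> - I) (filter (\<lambda>j. j \<in> J) [0..<js ! k])"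
    using take_filter_upt [of k "\<lambda>j. j \<in> J" r] assms by (simp only: js_def)
  finally show ?thesis
    by (simp add: flat_word_eq flat_betas_def nths_map take_map conj_commute)
qed

lemma flat_word_gens: "set (flat_word R Q I F) \<subseteq> cgens (flat_group R F)"
  using beta_simple set_js by (auto simp: flat_word_eq)

lemma root_function_flat:
  assumes "k < length js"
  shows "root_function (flat_group R F) (flat_word R Q I F) (flat_facet R Q I F) k = rf Q I (js ! k)"
proof -
  let ?QF = "flat_word R Q I F" and ?IF = "flat_facet R Q I F"
  have "{..<k} - ?IF = - ?IF \<inter> {..<k}" by auto
  then have "nths ?QF ({..<k} - ?IF) = map reflect (flat_betas (- I) (js ! k))"
    using nths_flat_word_take [OF assms] by (simp add: nths_take)
  then have "root_function (flat_group R F) ?QF ?IF k =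
      act (wp (map reflect (flat_betas (- I) (js ! k)))) (beta (js ! k))"
    using assms js_nth [OF assms]
    by (simp add: root_function_def subword_prod_def flat_word_eq croot_flat_group beta_simple)
  then show ?thesis using root_function_factorization js_nth [OF assms] by simp
qed

lemma root_list_flat:
  "root_list (flat_group R F) (flat_word R Q I F) (flat_facet R Q I F) = F"
proof -
  have "root_list (flat_group R F) (flat_word R Q I F) (flat_facet R Q I F) =
      map (\<lambda>k. rf Q I (js ! k)) [0..<length js]"
    using root_function_flat by (simp add: root_list_def)
  also have "\<dots> = map (rf Q I) (map ((!) js) [0..<length js])" by simp
  also have "\<dots> = F" unfolding map_nth using flat_eq by (simp add: js_def)
  finally show ?thesis .
qed

lemma flat_element_eq:
  "flat_element R Q I F = wp (map reflect (flat_betas (- I) r))"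
proof -
  have "nths (flat_word R Q I F) ({..<length js} - flat_facet R Q I F) =
      map reflect (flat_betas (- I) r)"
    by (intro nths_flat_word) (auto simp: flat_facet_eq)
  then show ?thesis by (simp add: flat_element_def subword_prod_def)
qed

lemma flat_element_closed: "flat_element R Q I F \<in> carrier (cgroup (flat_group R F))"
  unfolding flat_element_eq flat_group_simps
  using flat_betas_simple by (intro W.word_prod_in_generate) auto

lemma nths_split_at:
  assumes "j < r" "j \<in> X"
  shows "\<exists>v. nths Q X = nths (take j Q) X @ Q ! j # v"
proof -
  have "nths (take j Q @ Q ! j # drop (Suc j) Q) X = nths (take j Q) X @ Q ! j #
      nths (drop (Suc j) Q) {i. Suc i + j \<in> X}"
    using assms by (simp add: nths_append nths_Cons min_def)
  then show ?thesis using id_take_nth_drop [OF assms(1)] by metis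
qed

section \<open>Comparing reduced words and faces\<close>

context
  fixes \<pi> :: 'w
  assumes facet: "I \<in> facets (subword_complex R Q \<pi>)"
begin

lemma I_subset: "I \<subseteq> {..<r}" and I_reduced: "reduced_expression R \<pi> (nths Q (- I))"
  using facet by (auto simp: facets_subword_complex_iff)

lemma root_function_pos: "j < r \<Longrightarrow> j \<notin> I \<Longrightarrow> rf Q I j \<in> pos_roots R"
  using nths_split_at [of j "- I"] I_reduced reduced_prefix_root_pos
  by (metis ComplI root_function_take)

text \<open>The prefix roots of this word are values of the root function at positions outside
  \<open>I\<close>, and these are positive because \<open>I\<close> is a facet.\<close>

lemma flat_complement_reduced:
  "reduced_expression (flat_group R F) (flat_element R Q I F) (map reflect (flat_betas (- I) r))"
  unfolding flat_element_eq
proof (rule reduced_expression_flat_group [OF flat_betas_simple])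
  fix k assume k: "k < length (flat_betas (- I) r)"
  define ls where "ls = filter (\<lambda>j. j \<in> - I \<and> j \<in> J) [0..<r]"
  have kl: "k < length ls" using k by (simp add: ls_def flat_betas_def)
  then have l: "ls ! k \<notin> I" "ls ! k < r" using nth_mem [OF kl] by (auto simp: ls_def)
  have "take k ls = filter (\<lambda>j. j \<in> - I \<and> j \<in> J) [0..<ls ! k]"
    unfolding ls_def by (rule take_filter_upt) (use kl in \<open>simp add: ls_def\<close>)
  then have "take k (flat_betas (- I) r) = flat_betas (- I) (ls ! k)"
    by (simp add: flat_betas_def take_map ls_def)
  moreover have "flat_betas (- I) r ! k = beta (ls ! k)"
    using kl by (simp add: flat_betas_def ls_def)
  ultimately show "act (wp (map reflect (take k (flat_betas (- I) r)))) (flat_betas (- I) r ! k)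
      \<in> pos_roots R"
    using root_function_pos l root_function_factorization by simp
qed

lemma flat_facet_facet:
  "flat_facet R Q I F \<in> facets (subword_complex (flat_group R F) (flat_word R Q I F) (flat_element R Q I F))"
proof -
  have "nths (flat_word R Q I F) (- flat_facet R Q I F) = map reflect (flat_betas (- I) r)"
    by (intro nths_flat_word) (auto simp: flat_facet_eq)
  then show ?thesis
    unfolding facets_subword_complex_iff using flat_complement_reduced
    by (auto simp: flat_facet_eq)
qed

text \<open>Both sides compare product and length with the word outside \<open>I\<close>. The factor
  \<open>pre r\<close> cancels from the products, and the number of letters off the flat is the same
  for every such \<open>X\<close>.\<close>

lemma reduced_iff_flat_reduced:
  assumes X: "\<And>j. j < r \<Longrightarrow> j \<notin> J \<Longrightarrow> j \<in> X \<longleftrightarrow> j \<notin> I"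
    and Y: "\<And>k. k < length js \<Longrightarrow> k \<in> Y \<longleftrightarrow> js ! k \<in> X"
  shows "reduced_expression R \<pi> (nths Q X) \<longleftrightarrow>
    reduced_expression (flat_group R F) (flat_element R Q I F) (nths (flat_word R Q I F) Y)"
proof -
  have prod: "wp (nths Q X) = wp (map reflect (flat_betas X r)) \<bullet> pre r"
    if "\<And>j. j < r \<Longrightarrow> j \<notin> J \<Longrightarrow> j \<in> X \<longleftrightarrow> j \<notin> I" for X
    unfolding nths_conv_filter_upt using that by (intro word_factorization) auto
  have len: "length (nths Q X) = length (map reflect (flat_betas X r)) +
      length (filter (\<lambda>j. j \<notin> I \<and> j \<notin> J) [0..<r])"
    if "\<And>j. j < r \<Longrightarrow> j \<notin> J \<Longrightarrow> j \<in> X \<longleftrightarrow> j \<notin> I" for X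
  proof -
    have "filter (\<lambda>j. j \<in> X \<and> j \<notin> J) [0..<r] = filter (\<lambda>j. j \<notin> I \<and> j \<notin> J) [0..<r]"
      using that by (intro filter_cong) auto
    then show ?thesis
      unfolding nths_conv_filter_upt flat_betas_def length_map
      by (subst length_filter_split [where A = "\<lambda>j. j \<in> J"]) simp
  qed
  \<comment> \<open>Given one reduced expression, reducedness becomes equality of product and
    length; stated for any record so that it serves \<open>W\<close> and
    \<open>W\<^sub>F\<close>.\<close>
  have red_iff: "reduced_expression R' w u \<longleftrightarrow> word_prod (cgroup R') u = w \<and> length u = length v"
    if "reduced_expression R' w v" "set u \<subseteq> cgens R'"
    for R' :: "('w, 'v) reflection_group" and w u v
    using that reduced_expression_length_eq [of R' w u v] unfolding reduced_expression_def by auto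
  have "reduced_expression R \<pi> (nths Q X) \<longleftrightarrow>
      wp (nths Q X) = wp (nths Q (- I)) \<and> length (nths Q X) = length (nths Q (- I))"
    using red_iff [OF I_reduced, of "nths Q X"] I_reduced set_nths_subsetI [OF Q]
    by (auto simp: reduced_expression_def)
  also have "\<dots> \<longleftrightarrow> wp (map reflect (flat_betas X r)) = flat_element R Q I F \<and>
      length (map reflect (flat_betas X r)) = length (map reflect (flat_betas (- I) r))"
    using prod [OF X] prod [of "- I"] len [OF X] len [of "- I"]
      reflections_closed [OF flat_betas_roots [of r X]]
      reflections_closed [OF flat_betas_roots [of r "- I"]]
    by (simp add: flat_element_eq)
  also have "\<dots> \<longleftrightarrow> reduced_expression (flat_group R F) (flat_element R Q I F) (nths (flat_word R Q I F) Y)"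
    using red_iff [OF flat_complement_reduced, of "nths (flat_word R Q I F) Y"]
      set_nths_subsetI [OF flat_word_gens, of Y] nths_flat_word [of Y X, OF Y]
    by simp
  finally show ?thesis .
qed

lemma flat_bar_eq: "flat_bar R Q I F = I \<inter> J"
proof -
  have "(!) js ` {k. k < length js \<and> js ! k \<in> I} = I \<inter> set js"
    by (auto simp: in_set_conv_nth)
  then show ?thesis by (simp add: flat_bar_def flat_facet_eq flat_pos_js set_js)
qed

text \<open>The facet comparison with \<open>- X\<close> as second facet: its hypothesis says that
  \<open>X\<close> avoids the part of \<open>I\<close> off the flat.\<close>

lemma link_face_agrees:
  assumes X: "X \<subseteq> {..<r}" "X \<inter> (I - J) = {}" "reduced_expression R \<pi> (nths Q X)"
    and j: "j < r" "j \<notin> J"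
  shows "j \<in> X \<longleftrightarrow> j \<notin> I"
proof -
  have "(rf Q I j \<in> V \<longleftrightarrow> rf Q (- X) j \<in> V) \<and> (rf Q I j \<notin> V \<longrightarrow> (j \<in> I \<longleftrightarrow> j \<in> - X))"
    by (rule flat_positions_transfer [OF Q _ I_reduced])
      (use X j flat_positions_iff in \<open>auto simp: subspace_span\<close>)
  then show ?thesis using j by (auto simp: flat_positions_iff)
qed

lemma face_iff_link:
  assumes "A \<subseteq> {..<length js}"
  shows "A \<in> subword_complex (flat_group R F) (flat_word R Q I F) (flat_element R Q I F) \<longleftrightarrow>
    (!) js ` A \<in> link (subword_complex R Q \<pi>) (I - J)"
proof
  assume "A \<in> subword_complex (flat_group R F) (flat_word R Q I F) (flat_element R Q I F)"
  then obtain Y where Y: "Y \<subseteq> {..<length js} - A"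
    "reduced_expression (flat_group R F) (flat_element R Q I F) (nths (flat_word R Q I F) Y)"
    by (auto simp: subword_complex_iff)
  \<comment> \<open>\<open>Y\<close> prescribes the letters at the flat; off the flat
    \<open>X\<close> must copy the complement of \<open>I\<close>.\<close>
  define X where "X = (!) js ` Y \<union> ({..<r} - I - J)"
  have js_Y: "js ! k \<in> (!) js ` Y \<longleftrightarrow> k \<in> Y" if "k < length js" for k
  proof
    assume "js ! k \<in> (!) js ` Y"
    then obtain k' where "k' \<in> Y" "js ! k = js ! k'" by auto
    moreover from this have "k' < length js" using Y by auto
    ultimately show "k \<in> Y" using nth_eq_iff_index_eq [OF distinct_js that] by auto
  qed auto
  have Y_J: "(!) js ` Y \<subseteq> J" using js_nth Y by auto
  have "reduced_expression R \<pi> (nths Q X)"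
    by (rule reduced_iff_flat_reduced [where Y = Y, THEN iffD2, OF _ _ Y(2)])
      (use Y_J js_Y js_nth in \<open>auto simp: X_def\<close>)
  moreover have AJ: "(!) js ` A \<subseteq> J" using js_nth assms by auto
  moreover have "X \<inter> (!) js ` A = {}"
    using js_Y Y assms AJ by (auto simp: X_def)
  moreover have "X \<subseteq> {..<r}" "X \<inter> (I - J) = {}"
    using Y_J flat_positions_subset by (auto simp: X_def)
  ultimately show "(!) js ` A \<in> link (subword_complex R Q \<pi>) (I - J)"
    using I_subset flat_positions_subset unfolding link_def mem_Collect_eq subword_complex_iff
    by (intro conjI exI [of _ X]) auto
next
  assume "(!) js ` A \<in> link (subword_complex R Q \<pi>) (I - J)"
  then obtain X where X: "X \<subseteq> {..<r} - ((!) js ` A \<union> (I - J))" "reduced_expression R \<pi> (nths Q X)"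
    by (auto simp: link_def subword_complex_iff)
  define Y where "Y = {k. k < length js \<and> js ! k \<in> X}"
  have "reduced_expression (flat_group R F) (flat_element R Q I F) (nths (flat_word R Q I F) Y)"
  proof (rule reduced_iff_flat_reduced [THEN iffD1, OF _ _ X(2)])
    show "j \<in> X \<longleftrightarrow> j \<notin> I" if "j < r" "j \<notin> J" for j
      using that X by (intro link_face_agrees) auto
  qed (auto simp: Y_def)
  moreover have "Y \<subseteq> {..<length js} - A" using X by (auto simp: Y_def)
  ultimately show "A \<in> subword_complex (flat_group R F) (flat_word R Q I F) (flat_element R Q I F)"
    unfolding subword_complex_iff using assms by auto
qed

lemma link_subset:
  assumes "L \<in> link (subword_complex R Q \<pi>) (I - J)" shows "L \<subseteq> J"
proof
  fix l assume l: "l \<in> L"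
  obtain X where X: "L \<subseteq> {..<r}" "L \<inter> (I - J) = {}" "X \<subseteq> {..<r} - (L \<union> (I - J))"
    "reduced_expression R \<pi> (nths Q X)"
    using assms by (auto simp: link_def subword_complex_iff)
  show "l \<in> J"
  proof (rule ccontr)
    assume "l \<notin> J"
    then have "l \<in> X \<longleftrightarrow> l \<notin> I" using X l by (intro link_face_agrees) auto
    then show False using X l \<open>l \<notin> J\<close> by auto
  qed
qed

lemma flat_complex_isomorphic_link:
  "simplicial_isomorphic
    (subword_complex (flat_group R F) (flat_word R Q I F) (flat_element R Q I F))
    (link (subword_complex R Q \<pi>) (I - flat_bar R Q I F))"
proof -
  define K where "K = subword_complex (flat_group R F) (flat_word R Q I F) (flat_element R Q I F)"
  define L where "L = link (subword_complex R Q \<pi>) (I - J)"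
  have K: "A \<subseteq> {..<length js}" if "A \<in> K" for A
    using that by (auto simp: K_def subword_complex_iff)
  have iff: "A \<in> K \<longleftrightarrow> (!) js ` A \<in> L" if "A \<subseteq> {..<length js}" for A
    unfolding K_def L_def using face_iff_link [OF that] .
  \<comment> \<open>The isomorphism is \<open>k \<mapsto> js ! k\<close>. Since faces of the link
    contain only positions of the flat, each is the image of a set of indices.\<close>
  have lift: "\<exists>A \<subseteq> {..<length js}. C = (!) js ` A" if "C \<in> L" for C
  proof -
    have "(!) js ` {..<length js} = J" unfolding set_js [symmetric] by (auto simp: set_conv_nth)
    then have "C \<subseteq> (!) js ` {..<length js}" using link_subset that by (simp add: L_def)
    then show ?thesis by (auto simp: subset_image_iff)
  qed
  have "inj_on ((!) js) (\<Union>K)"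
    using K distinct_js by (intro inj_on_nth) auto
  moreover have "(!) js ` \<Union>K = \<Union>L"
  proof (intro subset_antisym subsetI)
    fix x assume "x \<in> (!) js ` \<Union>K"
    then obtain A k where "A \<in> K" "k \<in> A" "x = js ! k" by auto
    then show "x \<in> \<Union>L" using iff [OF K] by blast
  next
    fix x assume "x \<in> \<Union>L"
    then obtain C where C: "C \<in> L" "x \<in> C" by auto
    then obtain A where "A \<subseteq> {..<length js}" "C = (!) js ` A" using lift by blast
    then show "x \<in> (!) js ` \<Union>K" using iff C by blast
  qed
  moreover have "\<forall>A. A \<subseteq> \<Union>K \<longrightarrow> (A \<in> K \<longleftrightarrow> (!) js ` A \<in> L)"
    using K iff by (meson Sup_least order_trans)
  ultimately have "simplicial_isomorphic K L"
    unfolding simplicial_isomorphic_def bij_betw_def by blast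
  moreover have "I - flat_bar R Q I F = I - J" unfolding flat_bar_eq by auto
  ultimately show ?thesis by (simp only: K_def L_def)
qed

end

end

theorem mainTheorem2:
  fixes R :: "('w, 'v::real_vector) reflection_group"
    and m :: "'w \<Rightarrow> 'w \<Rightarrow> nat" and B :: "'v \<Rightarrow> 'v \<Rightarrow> real"
    and Q :: "'w list" and \<pi> :: 'w and I :: "nat set" and F :: "'v list"
  assumes "coxeter_root_system R m B"
    and "set Q \<subseteq> cgens R" and "\<pi> \<in> carrier (cgroup R)"
    and "I \<in> facets (subword_complex R Q \<pi>)"
    and "is_flat F (root_list R Q I)"
  shows "let R\<^sub>F = flat_group R F; Q\<^sub>F = flat_word R Q I F;
             I\<^sub>F = flat_facet R Q I F; \<pi>\<^sub>F = flat_element R Q I F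
         in set Q\<^sub>F \<subseteq> cgens R\<^sub>F \<and> \<pi>\<^sub>F \<in> carrier (cgroup R\<^sub>F) \<and>
            I\<^sub>F \<in> facets (subword_complex R\<^sub>F Q\<^sub>F \<pi>\<^sub>F) \<and>
            root_list R\<^sub>F Q\<^sub>F I\<^sub>F = F \<and>
            (\<forall>k<length Q\<^sub>F. root_function R\<^sub>F Q\<^sub>F I\<^sub>F k = root_function R Q I (flat_pos R Q I F k)) \<and>
            simplicial_isomorphic (subword_complex R\<^sub>F Q\<^sub>F \<pi>\<^sub>F)
              (link (subword_complex R Q \<pi>) (I - flat_bar R Q I F))"
proof -
  interpret subword_flat R m B Q I F
    by unfold_locales (use assms in auto)
  show ?thesis
    unfolding Let_def
    using flat_word_gens flat_element_closed flat_facet_facet [OF assms(4)] root_list_flat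
      root_function_flat flat_complex_isomorphic_link [OF assms(4)]
    by (simp add: flat_pos_js del: flat_group_simps)
qed

end
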